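(* Let $\ell \in \mathbb N$ be a constant and let $R \le n^{\ell}/2$. Let $A^{(1)}, A^{(2)}, \dots, A^{(\ell)}$ be $n \times R$ real matrices whose columns have unit Euclidean norm, and let $\widetilde{A}^{(1)}, \dots, \widetilde{A}^{(\ell)} \in \mathbb R^{n \times R}$ be their respective (independent) $\rho$-perturbations. Then for $\tau = (n/\rho)^{3^{\ell}}$, $$\mathrm{krank}_{\tau}\left(\widetilde{A}^{(1)} \odot \widetilde{A}^{(2)} \odot \dots \odot \widetilde{A}^{(\ell)}\right) = R$$ with probability at least $1 - \exp\left(-C n^{1/3^{\ell}}\right)$, where $C>0$ is a constant.
   Context: A $\rho$-perturbation of a vector $a \in \mathbb R^n$ is $\widetilde a = a + g$ where $g$ has independent Gaussian coordinates with mean $0$ and variance $\rho^2/n$; a $\rho$-perturbation of a matrix perturbs each column independently in this way. The Khatri-Rao product of matrices $U \in \mathbb R^{m \times R}$ and $V \in \mathbb R^{n\times R}$ is the $mn \times R$ matrix $U \odot V$ whose $i$-th column is $u_i \otimes v_i$ (iterated for more factors). For $\tau>0$, the $\tau$-robust Kruskal rank $\mathrm{krank}_\tau(A)$ of a matrix $A$ with $R$ columns is the largest $k$ such that for every set $S$ of $k$ columns, the submatrix $A_{|S}$ satisfies $\sigma_k(A_{|S}) \ge 1/\tau$ ($\sigma_k$ the $k$-th largest singular value).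
   Formalization: The formal theorem assumes ρ ≤ ρ_max for an arbitrary fixed ρ_max > 0, and C depends on ℓ and ρ_max; with C independent of any bound on ρ the claim fails (ℓ = 1, n = 2, R = 1, ρ → ∞). *)

theory Defs
  imports
    "HOL-Probability.Probability"
    "Jordan_Normal_Form.Char_Poly"
    "Jordan_Normal_Form.DL_Submatrix"
begin

definition euclid_norm :: "real Matrix.vec \<Rightarrow> real" where
  "euclid_norm v = sqrt (scalar_prod v v)"

definition tensor_vec :: "real Matrix.vec \<Rightarrow> real Matrix.vec \<Rightarrow> real Matrix.vec" where
  "tensor_vec u v = Matrix.vec (dim_vec u * dim_vec v)
     (\<lambda>i. vec_index u (i div dim_vec v) * vec_index v (i mod dim_vec v))"

definition khatri_rao :: "real mat \<Rightarrow> real mat \<Rightarrow> real mat" where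
  "khatri_rao U V = mat_of_cols (dim_row U * dim_row V)
     (map (\<lambda>j. tensor_vec (col U j) (col V j)) [0..<dim_col U])"

(* The product of the factors A 1, ..., A l; meant for 1 <= l. *)
definition khatri_rao_prod :: "nat \<Rightarrow> (nat \<Rightarrow> real mat) \<Rightarrow> real mat" where
  "khatri_rao_prod l A = foldl khatri_rao (A 1) (map A [2..<Suc l])"

(* One singular value for each column, in decreasing order and with multiplicity. A matrix
   with fewer rows than columns has the missing singular values set to 0 by this convention.
   The real roots of the characteristic polynomial are all of its roots, because the Gram
   matrix is symmetric. *)
definition singular_values :: "real mat \<Rightarrow> real list" where
  "singular_values A =
     rev (sorted_list_of_multiset (image_mset sqrt (proots (char_poly (transpose_mat A * A)))))"

(* The k-th largest singular value, for 1 <= k <= dim_col A. *)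
definition singular_value :: "real mat \<Rightarrow> nat \<Rightarrow> real" where
  "singular_value A k = singular_values A ! (k - 1)"

(* The case k = 0 imposes no condition, so the maximum is over a finite nonempty set. *)
definition robust_krank :: "real \<Rightarrow> real mat \<Rightarrow> nat" where
  "robust_krank \<tau> A = Max {k. k \<le> dim_col A \<and>
     (k = 0 \<or> (\<forall>S. S \<subseteq> {..<dim_col A} \<and> card S = k \<longrightarrow>
        singular_value (submatrix A UNIV S) k \<ge> 1 / \<tau>))}"

(* X 1, ..., X l are independent rho-perturbations of the n x R matrices A 1, ..., A l.
   The second argument of normal_density is the standard deviation. Independence of the
   coordinates of a column, of the columns, and of the matrices together amount to
   independence of the family of all noise entries. *)
definition rho_perturbations ::
  "'w measure \<Rightarrow> real \<Rightarrow> nat \<Rightarrow> nat \<Rightarrow> nat \<Rightarrow> (nat \<Rightarrow> real mat) \<Rightarrow> (nat \<Rightarrow> 'w \<Rightarrow> real mat) \<Rightarrow> bool" where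
  "rho_perturbations M \<rho> l n R A X \<longleftrightarrow>
     prob_space M \<and>
     (\<forall>k\<in>{1..l}. \<forall>\<omega>\<in>space M. X k \<omega> \<in> carrier_mat n R) \<and>
     (\<forall>k\<in>{1..l}. \<forall>i<n. \<forall>j<R.
        distributed M lborel (\<lambda>\<omega>. X k \<omega> $$ (i, j) - A k $$ (i, j))
          (normal_density 0 (\<rho> / sqrt (real n)))) \<and>
     prob_space.indep_vars M (\<lambda>_. borel)
       (\<lambda>(k, i, j) \<omega>. X k \<omega> $$ (i, j) - A k $$ (i, j)) ({1..l} \<times> {..<n} \<times> {..<R})"

end

theory Submission
  imports Defs
begin

text \<open>
  If the smallest singular value is below \<open>1 / \<tau>\<close>, then some column \<open>T\<close> of the product is almost
  orthogonal to every vector \<open>v\<close> with entries in \<open>[-1, 1]\<close> that annihilates the other columns.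
  These \<open>v\<close> form a space of dimension at least \<open>n^l / 2\<close>, independent of \<open>T\<close>. Picking normalised
  vectors greedily, each with a pivot entry of absolute value 1 and vanishing on the slices used
  before, and applying the pigeonhole principle at every level gives a tree of depth \<open>l\<close> in which
  each node has about \<open>n / (2 l)\<close> children. Along the children of a node the inner products are
  triangular linear forms in the entries of one factor, so that all of them are small only with
  probability \<open>p^s\<close>, where \<open>s\<close> is the number of children and \<open>p\<close> bounds the mass of a short
  interval. A union bound over the nodes and the columns settles all large \<open>n\<close>. For the finitely
  many remaining \<open>n\<close>, the noise density dominates a multiple of the uniform density on a long
  interval, for which \<open>p\<close> can be taken small enough that \<open>s = 1\<close> suffices.
\<close>

text \<open>The inner product of a fixed vector with a column of the product is a polynomial of
  degree \<open>l\<close> in the noise, and the small ball bound for a single one is far from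
  exponentially small at a threshold polynomial in \<open>n\<close>. Triangularity supplies about
  \<open>n\<close> factors of this kind although the linear forms are not independent. The number of
  children is dictated by a budget of rows: each level of the tree imposes at most
  \<open>(s - 1) * n ^ (l - 1)\<close> zeros, and all \<open>l\<close> levels together have to fit
  into the half of the \<open>n ^ l\<close> dimensions that the columns leave free. A bound on
  \<rho> enters because, for fixed \<open>n\<close> and growing \<rho>, the singular values scale
  like \<rho>^l while 1/\<tau> grows like \<rho>^(3^l). A single constant has to serve all
  \<open>n\<close>; where the union bound may exceed 1, a positive lower bound that is uniform in
  the matrices, in \<rho> and in the sample space takes its place. The rank condition also has to
  define a measurable event, which is why witnesses are rational vectors and eigenvalue bounds are
  tested at rational points.\<close>

section \<open>Echelon trees in families of vectors\<close>

text \<open>The base \<open>n\<close> digits of \<open>q\<close> select one entry from each factor,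
  the last factor reading the least significant digit. Factors are counted from 1, as in
  \<open>khatri_rao_prod\<close>.\<close>

primrec tensor_entry :: "nat \<Rightarrow> nat \<Rightarrow> (nat \<Rightarrow> nat \<Rightarrow> real) \<Rightarrow> nat \<Rightarrow> real" where
  "tensor_entry n 0 f q = 1"
| "tensor_entry n (Suc l) f q = tensor_entry n l f (q div n) * f (Suc l) (q mod n)"

text \<open>
  The tree branches on the least significant digit of the index. No upper bound on the slices is
  asked for: only the pivot entries matter for the small ball estimate.
\<close>

primrec echelon_tree :: "nat \<Rightarrow> nat \<Rightarrow> nat \<Rightarrow> (nat \<Rightarrow> real) set \<Rightarrow> bool" where
  "echelon_tree s n 0 F \<longleftrightarrow> (\<exists>v\<in>F. 1 \<le> \<bar>v 0\<bar>)"
| "echelon_tree s n (Suc m) F \<longleftrightarrow> (\<exists>p G. \<forall>a<s. p a < n \<and> G a \<subseteq> F \<and>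
     echelon_tree s n m ((\<lambda>v q. v (q * n + p a)) ` G a) \<and>
     (\<forall>v\<in>G a. \<forall>b<a. \<forall>q<n ^ m. v (q * n + p b) = 0))"

text \<open>This is what is used of a linear space of dimension greater than \<open>d\<close>: after
  \<open>d\<close> prescribed zeros a nonzero vector is left and can be scaled to maximum norm 1. In
  this form the notion passes to subfamilies with prescribed zeros without any dimension
  theory.\<close>

definition pivot_rich :: "(nat \<Rightarrow> real) set \<Rightarrow> nat \<Rightarrow> nat \<Rightarrow> bool" where
  "pivot_rich V N d \<longleftrightarrow> (\<forall>Z\<subseteq>{..<N}. card Z \<le> d \<longrightarrow>
     (\<exists>v\<in>V. (\<forall>q\<in>Z. v q = 0) \<and> (\<forall>q<N. \<bar>v q\<bar> \<le> 1) \<and> (\<exists>q<N. \<bar>v q\<bar> = 1)))"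

lemma pivot_rich_vanishing:
  assumes "pivot_rich V N (d + e)" "Z \<subseteq> {..<N}" "card Z \<le> e"
  shows "pivot_rich {v \<in> V. \<forall>q\<in>Z. v q = 0} N d"
  unfolding pivot_rich_def
proof (intro allI impI)
  fix Y assume "Y \<subseteq> {..<N}" "card Y \<le> d"
  then have "Y \<union> Z \<subseteq> {..<N}" "card (Y \<union> Z) \<le> d + e"
    using assms card_Un_le[of Y Z] by auto
  from assms(1)[unfolded pivot_rich_def, rule_format, OF this]
  obtain v where v: "v \<in> V" "\<forall>q\<in>Y \<union> Z. v q = 0" "\<forall>q<N. \<bar>v q\<bar> \<le> 1" "\<exists>q<N. \<bar>v q\<bar> = 1"
    by (elim bexE conjE)
  show "\<exists>v\<in>{v \<in> V. \<forall>q\<in>Z. v q = 0}. (\<forall>q\<in>Y. v q = 0) \<and> (\<forall>q<N. \<bar>v q\<bar> \<le> 1) \<and> (\<exists>q<N. \<bar>v q\<bar> = 1)"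
    by (rule bexI[of _ v]) (use v in simp_all)
qed

lemma digit_append_less:
  fixes q r b M :: nat
  assumes "q < M" "r < b"
  shows "q * b + r < M * b"
proof -
  have "q * b + r < (q + 1) * b" using assms by simp
  also have "\<dots> \<le> M * b" using assms by (intro mult_right_mono) auto
  finally show ?thesis .
qed

lemma card_residue_class:
  fixes N B r :: nat
  assumes "r < B"
  shows "card {q. q < N * B \<and> q mod B = r} \<le> N"
proof -
  have "{q. q < N * B \<and> q mod B = r} \<subseteq> (\<lambda>a. a * B + r) ` {..<N}"
  proof
    fix q assume "q \<in> {q. q < N * B \<and> q mod B = r}"
    then have "q div B < N" "q = q div B * B + r"
      using assms by (auto simp: less_mult_imp_div_less)
    then show "q \<in> (\<lambda>a. a * B + r) ` {..<N}" by blast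
  qed
  then show ?thesis
    using surj_card_le[of "{..<N}"] by simp
qed

text \<open>The enumeration \<open>h\<close> has to be increasing: zeros are prescribed only on the
  slices of earlier choices, and this direction must survive the selection.\<close>

lemma pigeonhole_strict_mono:
  fixes f :: "nat \<Rightarrow> nat"
  assumes "\<And>a. a < (s - 1) * B + 1 \<Longrightarrow> f a < B" "1 \<le> s"
  shows "\<exists>y h. y < B \<and> (\<forall>a<s. h a < (s - 1) * B + 1 \<and> f (h a) = y) \<and> (\<forall>a<s. \<forall>b<a. h b < h a)"
proof -
  let ?A = "{..<(s - 1) * B + 1}"
  have "0 < B" using assms(1)[of 0] by auto
  then have "\<exists>y\<in>{..<B}. card (f -` {y} \<inter> ?A) * card {..<B} \<ge> card ?A"
    using assms by (intro pigeonhole_card) auto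
  then obtain y where y: "y < B" "(s - 1) * B + 1 \<le> card (f -` {y} \<inter> ?A) * B" by auto
  have "s \<le> card (f -` {y} \<inter> ?A)"
  proof (rule ccontr)
    assume "\<not> s \<le> card (f -` {y} \<inter> ?A)"
    then have "card (f -` {y} \<inter> ?A) \<le> s - 1" by simp
    then have "card (f -` {y} \<inter> ?A) * B \<le> (s - 1) * B" by (rule mult_right_mono) simp
    with y(2) show False by linarith
  qed
  moreover obtain h where h: "bij_betw h {..<card (f -` {y} \<inter> ?A)} (f -` {y} \<inter> ?A)"
    "strict_mono_on {..<card (f -` {y} \<inter> ?A)} h"
    using ex_bij_betw_strict_mono_card[of "f -` {y} \<inter> ?A"] by auto
  ultimately have "h a < (s - 1) * B + 1 \<and> f (h a) = y" if "a < s" for a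
    using bij_betwE[OF h(1)] that by fastforce
  moreover have "h b < h a" if "b < a" "a < s" for a b
    using h(2) that \<open>s \<le> _\<close> by (auto simp: strict_mono_on_def)
  ultimately show ?thesis using y(1) by blast
qed

text \<open>A subtree comes with an uncontrolled suffix of \<open>k + 1\<close> digits. Among
  \<open>(s - 1) * n ^ k + 1\<close> subtrees, \<open>s\<close> agree in the low \<open>k\<close>
  digits and so become siblings. Each choice blocks one residue class modulo
  \<open>n ^ (k + 1)\<close>; with \<open>m\<close> levels left below, this is at most
  \<open>n ^ m\<close> indices. The total per level is \<open>(s - 1) * n ^ (l - 1)\<close> whatever
  \<open>k\<close> is, so the budget is linear in the depth.\<close>

lemma echelon_tree_exists:
  assumes "k + m = l" "1 \<le> s" "1 \<le> n" "pivot_rich V (n ^ l) (m * ((s - 1) * n ^ (l - 1)))"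
  shows "\<exists>r F. r < n ^ k \<and> F \<subseteq> V \<and> finite F \<and> (\<forall>v\<in>F. \<forall>q<n ^ l. \<bar>v q\<bar> \<le> 1) \<and>
    echelon_tree s n m ((\<lambda>v q. v (q * n ^ k + r)) ` F)"
  using assms
proof (induction m arbitrary: k V)
  case 0
  then obtain v where v: "v \<in> V" "\<forall>q<n ^ l. \<bar>v q\<bar> \<le> 1" "\<exists>q<n ^ l. \<bar>v q\<bar> = 1"
    unfolding pivot_rich_def by (elim allE[of _ "{}"]) auto
  then obtain r where r: "r < n ^ l" "\<bar>v r\<bar> = 1" by blast
  have "k = l" using 0 by simp
  with v r show ?case by (intro exI[of _ r] exI[of _ "{v}"] conjI) simp_all
next
  case (Suc m)
  define M where "M = (s - 1) * n ^ k + 1"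
  define blk where "blk r = {q. q < n ^ l \<and> q mod n ^ Suc k = r}" for r
  define Z where "Z g a = (\<Union>b<a. blk (fst (g b)))" for g :: "nat \<Rightarrow> nat \<times> (nat \<Rightarrow> real) set" and a
  \<comment> \<open>Each choice depends on the blocks used by all earlier ones, hence the dependent
    choice. The guard \<open>a < M\<close> makes it total: beyond \<open>M\<close> the budget no
    longer guarantees a candidate.\<close>
  define P where "P g a x \<longleftrightarrow> (a < M \<longrightarrow> fst x < n ^ Suc k \<and> snd x \<subseteq> {v\<in>V. \<forall>q\<in>Z g a. v q = 0} \<and> finite (snd x) \<and>
     (\<forall>v\<in>snd x. \<forall>q<n ^ l. \<bar>v q\<bar> \<le> 1) \<and> echelon_tree s n m ((\<lambda>v q. v (q * n ^ Suc k + fst x)) ` snd x))"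
    for g a x
  have l: "n ^ l = n ^ m * n ^ Suc k" "l - 1 = m + k"
    using Suc.prems(1) by (auto simp flip: power_add simp: add.commute)
  have "\<exists>g. \<forall>a. P g a (g a)"
  proof (rule dependent_wf_choice[of less_than P])
    show "P g a x = P g' a x" if "\<And>z. (z, a) \<in> less_than \<Longrightarrow> g z = g' z" for g g' a x
      using that by (simp add: P_def Z_def)
    show "\<exists>x. P g a x" if prev: "\<And>y. (y, a) \<in> less_than \<Longrightarrow> P g y (g y)" for a g
    proof (cases "a < M")
      case True
      have "card (Z g a) \<le> (\<Sum>b<a. card (blk (fst (g b))))"
        unfolding Z_def by (rule card_UN_le) simp
      also have "\<dots> \<le> (\<Sum>b<a. n ^ m)"
      proof (intro sum_mono)
        fix b assume "b \<in> {..<a}"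
        then have "fst (g b) < n ^ Suc k" using prev[of b] True by (auto simp: P_def)
        then show "card (blk (fst (g b))) \<le> n ^ m"
          unfolding blk_def l by (rule card_residue_class)
      qed
      also have "\<dots> \<le> (s - 1) * n ^ k * n ^ m" using True by (simp add: M_def)
      finally have "card (Z g a) \<le> (s - 1) * n ^ (l - 1)"
        unfolding l(2) by (simp add: power_add mult_ac)
      moreover have "Z g a \<subseteq> {..<n ^ l}" by (auto simp: Z_def blk_def)
      ultimately have "pivot_rich {v\<in>V. \<forall>q\<in>Z g a. v q = 0} (n ^ l) (m * ((s - 1) * n ^ (l - 1)))"
        using Suc.prems(4) by (intro pivot_rich_vanishing) (auto simp: add.commute)
      from Suc.IH[OF _ Suc.prems(2,3) this, of "Suc k"] Suc.prems(1) show ?thesis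
        by (auto simp: P_def)
    qed (auto simp: P_def)
  qed simp
  then obtain g where "\<forall>a. P g a (g a)" by blast
  then have g: "fst (g a) < n ^ Suc k" "snd (g a) \<subseteq> V" "finite (snd (g a))"
    "\<And>v q. v \<in> snd (g a) \<Longrightarrow> q \<in> Z g a \<Longrightarrow> v q = 0" "\<forall>v\<in>snd (g a). \<forall>q<n ^ l. \<bar>v q\<bar> \<le> 1"
    "echelon_tree s n m ((\<lambda>v q. v (q * n ^ Suc k + fst (g a))) ` snd (g a))" if "a < M" for a
    using that unfolding P_def by blast+
  have "\<And>a. a < (s - 1) * n ^ k + 1 \<Longrightarrow> fst (g a) mod n ^ k < n ^ k" using Suc.prems by simp
  from pigeonhole_strict_mono[of s "n ^ k" "\<lambda>a. fst (g a) mod n ^ k", OF this Suc.prems(2)]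
  obtain r h where r: "r < n ^ k" and h: "\<And>a. a < s \<Longrightarrow> h a < M \<and> fst (g (h a)) mod n ^ k = r"
    and mono: "\<And>a b. b < a \<Longrightarrow> a < s \<Longrightarrow> h b < h a"
    unfolding M_def by blast
  \<comment> \<open>Siblings share the low digits \<open>r\<close>; the digit in front of them is
    the position of the child.\<close>
  define p where "p a = fst (g (h a)) div n ^ k" for a
  define F where "F = (\<Union>a<s. snd (g (h a)))"
  have p: "p a < n" if "a < s" for a
    unfolding p_def using g(1)[of "h a"] h[OF that] by (auto intro: less_mult_imp_div_less simp: mult.commute)
  have idx: "(q * n + p a) * n ^ k + r = q * n ^ Suc k + fst (g (h a))" if "a < s" for q a
  proof -
    have "fst (g (h a)) = p a * n ^ k + r"
      unfolding p_def using h[OF that] by (metis div_mult_mod_eq)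
    then show ?thesis by (simp add: algebra_simps)
  qed
  show ?case
  proof (intro exI conjI)
    show "r < n ^ k" by fact
    show "F \<subseteq> V" unfolding F_def using g(2) h by blast
    show "finite F" unfolding F_def using g(3) h by blast
    show "\<forall>v\<in>F. \<forall>q<n ^ l. \<bar>v q\<bar> \<le> 1" unfolding F_def using g(5) h by blast
    show "echelon_tree s n (Suc m) ((\<lambda>v q. v (q * n ^ k + r)) ` F)"
      unfolding echelon_tree.simps
    proof (intro exI[of _ p] exI[of _ "\<lambda>a. (\<lambda>v q. v (q * n ^ k + r)) ` snd (g (h a))"] allI impI conjI ballI)
      fix a assume a: "a < s"
      show "p a < n" by (rule p[OF a])
      show "(\<lambda>v q. v (q * n ^ k + r)) ` snd (g (h a)) \<subseteq> (\<lambda>v q. v (q * n ^ k + r)) ` F"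
        using a by (auto simp: F_def)
      have "(\<lambda>v q. v (q * n + p a)) ` (\<lambda>v q. v (q * n ^ k + r)) ` snd (g (h a)) =
            (\<lambda>v q. v (q * n ^ Suc k + fst (g (h a)))) ` snd (g (h a))"
        unfolding image_image idx[OF a] ..
      then show "echelon_tree s n m ((\<lambda>v q. v (q * n + p a)) ` (\<lambda>v q. v (q * n ^ k + r)) ` snd (g (h a)))"
        using g(6) h[OF a] by simp
      fix w b q assume w: "w \<in> (\<lambda>v q. v (q * n ^ k + r)) ` snd (g (h a))" and b: "b < a" and q: "q < n ^ m"
      then obtain v where v: "v \<in> snd (g (h a))" "w = (\<lambda>q. v (q * n ^ k + r))" by blast
      have bs: "b < s" using a b by simp
      let ?i = "q * n ^ Suc k + fst (g (h b))"
      have lt: "fst (g (h b)) < n ^ Suc k" using g(1) h[OF bs] by blast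
      have "?i \<in> blk (fst (g (h b)))"
        unfolding blk_def l using digit_append_less[OF q lt] lt by simp
      then have "?i \<in> Z g (h a)" unfolding Z_def using mono[OF b a] by blast
      then show "w (q * n + p b) = 0"
        unfolding v(2) idx[OF bs] using g(4) h[OF a] v(1) by blast
    qed
  qed
qed

section \<open>Annihilators of few vectors\<close>

text \<open>Zero rows make the system square. Row \<open>m\<close> is one of them, so the transpose
  kills \<open>unit_vec N m\<close>, the determinant vanishes, and the padded matrix has a kernel
  vector too.\<close>

lemma underdetermined_homogeneous:
  fixes c :: "nat \<Rightarrow> nat \<Rightarrow> real"
  assumes "m < N"
  shows "\<exists>v. (\<exists>q<N. v q \<noteq> 0) \<and> (\<forall>i<m. (\<Sum>q<N. c i q * v q) = 0)"
proof -
  define A where "A = Matrix.mat N N (\<lambda>(i, q). if i < m then c i q else 0)"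
  have A: "A \<in> carrier_mat N N" by (simp add: A_def)
  have "transpose_mat A *\<^sub>v unit_vec N m = 0\<^sub>v N"
    using assms by (intro eq_vecI) (auto simp: A_def scalar_prod_def intro!: sum.neutral)
  then have "Determinant.det (transpose_mat A) = 0"
    by (intro iffD2[OF det_0_iff_vec_prod_zero_field[of _ N]] exI[of _ "unit_vec N m"] conjI)
       (use A assms in auto)
  then have "Determinant.det A = 0" using det_transpose[OF A] by simp
  then obtain v where v: "v \<in> carrier_vec N" "v \<noteq> 0\<^sub>v N" "A *\<^sub>v v = 0\<^sub>v N"
    using det_0_iff_vec_prod_zero_field[OF A] by blast
  have "\<exists>q<N. vec_index v q \<noteq> 0" using v by (auto intro: eq_vecI)
  moreover have "(\<Sum>q<N. c i q * vec_index v q) = 0" if "i < m" for i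
  proof -
    have "vec_index (A *\<^sub>v v) i = 0" using v assms that by simp
    then show ?thesis using that assms v(1) by (simp add: A_def scalar_prod_def atLeast0LessThan)
  qed
  ultimately show ?thesis by blast
qed

lemma underdetermined_homogeneous_set:
  fixes C :: "(nat \<Rightarrow> real) set"
  assumes "finite C" "card C < N"
  shows "\<exists>v. (\<exists>q<N. v q \<noteq> 0) \<and> (\<forall>c\<in>C. (\<Sum>q<N. c q * v q) = 0)"
proof -
  obtain h where h: "bij_betw h {0..<card C} C"
    using ex_bij_betw_nat_finite[OF assms(1)] by blast
  obtain v where "\<exists>q<N. v q \<noteq> 0" "\<forall>i<card C. (\<Sum>q<N. h i q * v q) = 0"
    using underdetermined_homogeneous[OF assms(2), of h] by blast
  moreover have "\<exists>i<card C. c = h i" if "c \<in> C" for c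
  proof -
    have "c \<in> h ` {0..<card C}" using bij_betw_imp_surj_on[OF h] that by simp
    then show ?thesis by auto
  qed
  ultimately show ?thesis by blast
qed

text \<open>Zeros on \<open>Z\<close> are further linear equations, given by coordinate functionals,
  and the system stays underdetermined. Dividing a solution by an entry of largest absolute value
  produces the pivot.\<close>

lemma pivot_rich_annihilator:
  assumes "finite C" "card C + d < N"
  shows "pivot_rich {v. \<forall>c\<in>C. (\<Sum>q<N. c q * v q) = 0} N d"
  unfolding pivot_rich_def
proof (intro allI impI)
  fix Z assume Z: "Z \<subseteq> {..<N}" "card Z \<le> d"
  then have finZ: "finite Z" using finite_subset by blast
  define D where "D = C \<union> (\<lambda>z q. if q = z then 1 else 0) ` Z"
  have "card D \<le> card C + card Z"
    unfolding D_def by (meson card_Un_le card_image_le finZ add_left_mono order_trans)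
  then obtain v where v: "\<exists>q<N. v q \<noteq> 0" "\<forall>c\<in>D. (\<Sum>q<N. c q * v q) = 0"
    using underdetermined_homogeneous_set[of D N] assms Z finZ by (auto simp: D_def)
  have "Max ((\<lambda>q. \<bar>v q\<bar>) ` {..<N}) \<in> (\<lambda>q. \<bar>v q\<bar>) ` {..<N}"
    using v(1) by (intro Max_in) auto
  then obtain r where r: "r < N" "Max ((\<lambda>q. \<bar>v q\<bar>) ` {..<N}) = \<bar>v r\<bar>" by blast
  have max: "\<bar>v q\<bar> \<le> \<bar>v r\<bar>" if "q < N" for q
    unfolding r(2)[symmetric] using that by (intro Max_ge) auto
  then have r0: "\<bar>v r\<bar> > 0" using v(1) by fastforce
  define w where "w q = v q / \<bar>v r\<bar>" for q
  have w: "(\<Sum>q<N. c q * w q) = 0" if "c \<in> D" for c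
    using v(2) that by (simp add: w_def flip: sum_divide_distrib)
  have "w q = 0" if "q \<in> Z" for q
  proof -
    have "(\<Sum>k<N. (if k = q then 1 else 0) * w k) = 0" using that by (intro w) (simp add: D_def)
    then show ?thesis using that Z(1) by (simp add: mult_delta_left subset_iff)
  qed
  moreover have "\<forall>q<N. \<bar>w q\<bar> \<le> 1" using max r0 by (simp add: w_def)
  moreover have "\<bar>w r\<bar> = 1" using r0 by (simp add: w_def)
  moreover have "w \<in> {v. \<forall>c\<in>C. (\<Sum>q<N. c q * v q) = 0}" using w by (simp add: D_def)
  ultimately show "\<exists>v\<in>{v. \<forall>c\<in>C. (\<Sum>q<N. c q * v q) = 0}.
      (\<forall>q\<in>Z. v q = 0) \<and> (\<forall>q<N. \<bar>v q\<bar> \<le> 1) \<and> (\<exists>q<N. \<bar>v q\<bar> = 1)"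
    using r(1) by (intro bexI[of _ w]) auto
qed

section \<open>Inner products with tensors, one factor at a time\<close>

lemma tensor_entry_cong:
  assumes "0 < n" "\<And>k i. 1 \<le> k \<Longrightarrow> k \<le> l \<Longrightarrow> i < n \<Longrightarrow> f k i = g k i"
  shows "tensor_entry n l f q = tensor_entry n l g q"
  using assms(2) by (induction l arbitrary: q) (simp_all add: assms(1))

lemma sum_lessThan_mult:
  fixes f :: "nat \<Rightarrow> 'a::comm_monoid_add"
  shows "(\<Sum>q<M * n. f q) = (\<Sum>q<M. \<Sum>i<n. f (q * n + i))"
proof -
  have shift: "sum f {a..<a + n} = (\<Sum>i<n. f (a + i))" for a
    using sum.shift_bounds_nat_ivl[of f 0 a n] by (simp add: add.commute lessThan_atLeast0)
  show ?thesis
    unfolding sum.nat_group[where k = n and n = M, symmetric] shift ..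
qed

text \<open>Once the factors up to \<open>l\<close> are fixed, a linear form in the last factor
  remains; its coefficients are inner products of slices with the shorter tensor. These are the
  slices on which \<open>echelon_tree\<close> recurses.\<close>

lemma tensor_inner_Suc:
  "(\<Sum>q<n ^ Suc l. v q * tensor_entry n (Suc l) f q) =
   (\<Sum>i<n. (\<Sum>q<n ^ l. v (q * n + i) * tensor_entry n l f q) * f (Suc l) i)"
proof -
  have "(\<Sum>q<n ^ Suc l. v q * tensor_entry n (Suc l) f q) =
    (\<Sum>q<n ^ l. \<Sum>i<n. v (q * n + i) * tensor_entry n l f q * f (Suc l) i)"
    unfolding power_Suc2 sum_lessThan_mult by (intro sum.cong refl) (simp add: mult.assoc)
  also have "\<dots> = (\<Sum>i<n. \<Sum>q<n ^ l. v (q * n + i) * tensor_entry n l f q * f (Suc l) i)"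
    by (rule sum.swap)
  finally show ?thesis by (simp add: sum_distrib_right)
qed

section \<open>Small ball estimates for product measures\<close>

text \<open>The laws are abstract because the argument is run twice, with Gaussian and with uniform
  entries, at different ratios between \<eta> and \<open>p\<close>.\<close>

locale small_ball_laws =
  fixes law :: "'i \<Rightarrow> real measure" and \<eta> :: real and p :: ennreal
  assumes prob_law: "prob_space (law i)"
    and sets_law[measurable_cong]: "sets (law i) = sets borel"
    and small_ball: "emeasure (law i) {c - \<eta>..c + \<eta>} \<le> p"
    and \<eta>_pos: "0 < \<eta>"
begin

sublocale product_sigma_finite law
  by (intro product_sigma_finite.intro prob_space_imp_sigma_finite prob_law)

lemma prob_space_PiM_law: "prob_space (PiM J law)"
  by (intro prob_space_PiM prob_law)

lemma emeasure_PiM_law_le_1: "emeasure (PiM J law) A \<le> 1"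
proof -
  interpret prob_space "PiM J law" by (rule prob_space_PiM_law)
  show ?thesis by (rule measure_le_1)
qed

text \<open>Dividing by a pivot coefficient of size at least \<kappa> confines the pivot coordinate
  to an interval of half-length \<eta>, wherever the other coordinates place its centre. The zeros
  \<open>c a (z b) = 0\<close> force distinct pivots, so each form contributes its own factor
  \<open>p\<close>.\<close>

lemma emeasure_triangular_forms_le:
  assumes "finite J" "0 < \<kappa>" "\<And>a. a < s \<Longrightarrow> z a \<in> J \<and> \<kappa> \<le> \<bar>c a (z a)\<bar>"
    "\<And>a b. b < a \<Longrightarrow> a < s \<Longrightarrow> c a (z b) = 0"
  shows "emeasure (PiM J law) {x \<in> space (PiM J law). \<forall>a<s. \<bar>\<Sum>i\<in>J. c a i * x i\<bar> \<le> \<kappa> * \<eta>} \<le> p ^ s"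
  using assms
proof (induction s arbitrary: J c z)
  case 0
  show ?case using emeasure_PiM_law_le_1 by simp
next
  case (Suc s)
  define S where "S = {x \<in> space (PiM J law). \<forall>a<Suc s. \<bar>\<Sum>i\<in>J. c a i * x i\<bar> \<le> \<kappa> * \<eta>}"
  define K where "K = J - {z 0}"
  define S' where "S' = {x \<in> space (PiM K law). \<forall>a<s. \<bar>\<Sum>i\<in>K. c (Suc a) i * x i\<bar> \<le> \<kappa> * \<eta>}"
  have [measurable]: "S \<in> sets (PiM J law)" unfolding S_def by measurable
  have [measurable]: "S' \<in> sets (PiM K law)" unfolding S'_def by measurable
  have J: "J = insert (z 0) K" "z 0 \<notin> K" and finK: "finite K"
    using Suc.prems(1) Suc.prems(3)[of 0] by (auto simp: K_def)
  have c0: "\<kappa> \<le> \<bar>c 0 (z 0)\<bar>" using Suc.prems(3)[of 0] by simp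
  have IH: "emeasure (PiM K law) S' \<le> p ^ s"
    unfolding S'_def
  proof (rule Suc.IH[OF finK Suc.prems(2)])
    show "z (Suc a) \<in> K \<and> \<kappa> \<le> \<bar>c (Suc a) (z (Suc a))\<bar>" if "a < s" for a
      using Suc.prems(2) Suc.prems(3)[of "Suc a"] Suc.prems(4)[of 0 "Suc a"] that by (auto simp: K_def)
    show "c (Suc a) (z (Suc b)) = 0" if "b < a" "a < s" for a b
      using Suc.prems(4) that by simp
  qed
  \<comment> \<open>Only the form with index 0 involves the coordinate \<open>z 0\<close>, so this coordinate is integrated first.\<close>
  have section_le: "(\<integral>\<^sup>+y. indicator S (x(z 0 := y)) \<partial>law (z 0)) \<le> indicator S' x * p"
    if x: "x \<in> space (PiM K law)" for x
  proof -
    define y0 where "y0 = - (\<Sum>i\<in>K. c 0 i * x i) / c 0 (z 0)"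
    have "indicator S (x(z 0 := y)) \<le> indicator S' x * (indicator {y0 - \<eta>..y0 + \<eta>} y :: ennreal)" for y
    proof (cases "x(z 0 := y) \<in> S")
      case True
      have sum: "(\<Sum>i\<in>J. c a i * (x(z 0 := y)) i) = c a (z 0) * y + (\<Sum>i\<in>K. c a i * x i)" for a
        unfolding J(1) using finK J(2) by (auto intro!: sum.cong)
      have "\<bar>\<Sum>i\<in>K. c (Suc a) i * x i\<bar> \<le> \<kappa> * \<eta>" if "a < s" for a
      proof -
        have "\<bar>\<Sum>i\<in>J. c (Suc a) i * (x(z 0 := y)) i\<bar> \<le> \<kappa> * \<eta>" using True that unfolding S_def by blast
        then show ?thesis unfolding sum using Suc.prems(4)[of 0 "Suc a"] that by simp
      qed
      then have "x \<in> S'" using x by (simp add: S'_def)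
      moreover have "\<bar>y - y0\<bar> \<le> \<eta>"
      proof -
        have ne: "c 0 (z 0) \<noteq> 0" using c0 Suc.prems(2) by auto
        have "\<bar>c 0 (z 0) * y + (\<Sum>i\<in>K. c 0 i * x i)\<bar> \<le> \<kappa> * \<eta>"
          using True unfolding S_def sum[symmetric] by blast
        moreover have "c 0 (z 0) * y + (\<Sum>i\<in>K. c 0 i * x i) = c 0 (z 0) * (y - y0)"
          using ne by (simp add: y0_def field_simps)
        ultimately have "\<bar>c 0 (z 0)\<bar> * \<bar>y - y0\<bar> \<le> \<kappa> * \<eta>" by (simp add: abs_mult)
        also have "\<dots> \<le> \<bar>c 0 (z 0)\<bar> * \<eta>" using c0 \<eta>_pos by (intro mult_right_mono) auto
        finally show ?thesis using ne by simp
      qed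
      ultimately show ?thesis by (auto simp: indicator_def abs_le_iff)
    qed auto
    then have "(\<integral>\<^sup>+y. indicator S (x(z 0 := y)) \<partial>law (z 0)) \<le>
      (\<integral>\<^sup>+y. indicator S' x * indicator {y0 - \<eta>..y0 + \<eta>} y \<partial>law (z 0))"
      by (intro nn_integral_mono)
    also have "\<dots> = indicator S' x * emeasure (law (z 0)) {y0 - \<eta>..y0 + \<eta>}"
      by (subst nn_integral_cmult) (auto simp: sets_law)
    also have "\<dots> \<le> indicator S' x * p" by (intro mult_left_mono small_ball) simp
    finally show ?thesis .
  qed
  have "emeasure (PiM J law) S = (\<integral>\<^sup>+x. indicator S x \<partial>PiM J law)" by simp
  also have "\<dots> = (\<integral>\<^sup>+x. \<integral>\<^sup>+y. indicator S (x(z 0 := y)) \<partial>law (z 0) \<partial>PiM K law)"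
    unfolding J(1) using finK J(2) by (intro product_nn_integral_insert) (simp_all flip: J(1))
  also have "\<dots> \<le> (\<integral>\<^sup>+x. indicator S' x * p \<partial>PiM K law)"
    by (intro nn_integral_mono section_le)
  also have "\<dots> = emeasure (PiM K law) S' * p" by (simp add: nn_integral_multc)
  also have "\<dots> \<le> p ^ s * p" by (intro mult_right_mono IH) simp
  finally show ?case unfolding S_def by (simp add: mult.commute)
qed

text \<open>Fubini over \<open>I\<close>: sections over the exceptional set \<open>B\<close> are
  bounded by 1, all others by \<open>d\<close>.\<close>

lemma emeasure_PiM_union_le:
  assumes "I \<inter> J = {}" "finite I" "finite J" and S: "S \<in> sets (PiM (I \<union> J) law)" and B: "B \<in> sets (PiM I law)"
    and "\<And>x. x \<in> space (PiM I law) \<Longrightarrow> x \<notin> B \<Longrightarrow>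
      emeasure (PiM J law) ((\<lambda>y. merge I J (x, y)) -` S \<inter> space (PiM J law)) \<le> d"
  shows "emeasure (PiM (I \<union> J) law) S \<le> emeasure (PiM I law) B + d"
proof -
  interpret I: prob_space "PiM I law" by (rule prob_space_PiM_law)
  have "emeasure (PiM (I \<union> J) law) S =
    (\<integral>\<^sup>+x. emeasure (PiM J law) ((\<lambda>y. merge I J (x, y)) -` S \<inter> space (PiM J law)) \<partial>PiM I law)"
    by (rule emeasure_fold_integral) fact+
  also have "\<dots> \<le> (\<integral>\<^sup>+x. indicator B x + d \<partial>PiM I law)"
  proof (intro nn_integral_mono)
    fix x assume "x \<in> space (PiM I law)"
    then show "emeasure (PiM J law) ((\<lambda>y. merge I J (x, y)) -` S \<inter> space (PiM J law)) \<le> indicator B x + d"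
      using assms(6)[of x] emeasure_PiM_law_le_1[of J] by (cases "x \<in> B") (auto intro!: add_increasing2)
  qed
  also have "\<dots> = emeasure (PiM I law) B + d"
    using B by (simp add: nn_integral_add I.emeasure_space_1)
  finally show ?thesis .
qed

end

section \<open>The small ball estimate along an echelon tree\<close>

locale tensor_laws = small_ball_laws law \<eta> p
  for law :: "nat \<times> nat \<times> nat \<Rightarrow> real measure" and \<eta> p +
  fixes n :: nat
  assumes n_pos: "1 \<le> n"
begin

text \<open>Column \<open>j\<close> of the product depends on these entries only, so it is
  independent of the vectors that annihilate the other columns.\<close>

definition coords :: "nat \<Rightarrow> nat \<Rightarrow> (nat \<times> nat \<times> nat) set" where
  "coords l j = {1..l} \<times> {..<n} \<times> {j}"

text \<open>Strictness matters at depth 0: the threshold is then 1, the leaf condition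
  \<open>1 \<le> \<bar>v 0\<bar>\<close> contradicts it, and the event is empty.\<close>

definition forms_small :: "nat \<Rightarrow> nat \<Rightarrow> (nat \<Rightarrow> real) set \<Rightarrow> (nat \<times> nat \<times> nat \<Rightarrow> real) set" where
  "forms_small l j F = {x \<in> space (PiM (coords l j) law).
     \<forall>v\<in>F. \<bar>\<Sum>q<n ^ l. v q * tensor_entry n l (\<lambda>k i. x (k, i, j)) q\<bar> < \<eta> ^ l}"

lemma tensor_entry_measurable:
  assumes "\<And>k i. k \<in> {1..l} \<Longrightarrow> i < n \<Longrightarrow> (\<lambda>x. g x k i) \<in> borel_measurable M"
  shows "(\<lambda>x. tensor_entry n l (g x) q) \<in> borel_measurable M"
  using assms
proof (induction l arbitrary: q)
  case (Suc l)
  have "(\<lambda>x. g x (Suc l) (q mod n)) \<in> borel_measurable M"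
    by (rule Suc.prems) (use n_pos in auto)
  moreover have "(\<lambda>x. tensor_entry n l (g x) (q div n)) \<in> borel_measurable M"
    by (rule Suc.IH) (use Suc.prems in auto)
  ultimately show ?case by simp
qed simp

lemma sets_forms_small:
  assumes "finite F"
  shows "forms_small l j F \<in> sets (PiM (coords l j) law)"
proof -
  have [measurable]: "(\<lambda>x. tensor_entry n l (\<lambda>k i. x (k, i, j)) q) \<in> borel_measurable (PiM (coords l j) law)" for q
  proof (rule tensor_entry_measurable)
    fix k i assume "k \<in> {1..l}" "i < n"
    then have [measurable]: "(k, i, j) \<in> coords l j" by (simp add: coords_def)
    show "(\<lambda>x. x (k, i, j)) \<in> borel_measurable (PiM (coords l j) law)" by measurable
  qed
  show ?thesis unfolding forms_small_def
    by (rule sets.sets_Collect_finite_All[OF _ assms]) measurable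
qed

text \<open>Either all forms of some child are small already, or every child offers a vector whose
  slice has inner product at least \<open>\<eta> ^ l\<close>; these inner products are the pivots of
  \<open>s\<close> triangular forms in the last factor. One \<open>p ^ s\<close> is paid for each
  inner node, and \<open>l * s ^ l\<close> is a crude count of them.\<close>

lemma emeasure_echelon_tree_small:
  assumes "1 \<le> s" "finite F" "echelon_tree s n l F"
  shows "emeasure (PiM (coords l j) law) (forms_small l j F) \<le> of_nat (l * s ^ l) * p ^ s"
  using assms(2,3)
proof (induction l arbitrary: F)
  case 0
  then have "forms_small 0 j F = {}" unfolding forms_small_def by force
  then show ?case by simp
next
  case (Suc l)
  obtain r G where rG: "\<forall>a<s. r a < n \<and> G a \<subseteq> F \<and>
     echelon_tree s n l ((\<lambda>v q. v (q * n + r a)) ` G a) \<and>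
     (\<forall>v\<in>G a. \<forall>b<a. \<forall>q<n ^ l. v (q * n + r b) = 0)"
    using Suc.prems(2) unfolding echelon_tree.simps by (elim exE)
  then have r: "\<And>a. a < s \<Longrightarrow> r a < n" and G: "\<And>a. a < s \<Longrightarrow> G a \<subseteq> F"
    and tree: "\<And>a. a < s \<Longrightarrow> echelon_tree s n l ((\<lambda>v q. v (q * n + r a)) ` G a)"
    and vanish: "\<And>a v b q. a < s \<Longrightarrow> v \<in> G a \<Longrightarrow> b < a \<Longrightarrow> q < n ^ l \<Longrightarrow> v (q * n + r b) = 0"
    by simp_all
  define slice where "slice a = (\<lambda>v q. v (q * n + r a)) ` G a" for a
  have fin: "finite (slice a)" if "a < s" for a
    unfolding slice_def using G[OF that] Suc.prems(1) by (auto intro: finite_subset)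
  define J where "J = {Suc l} \<times> {..<n} \<times> {j}"
  define B where "B = (\<Union>a<s. forms_small l j (slice a))"
  define S where "S = forms_small (Suc l) j F"
  have coords: "coords (Suc l) j = coords l j \<union> J" "coords l j \<inter> J = {}" "finite (coords l j)" "finite J"
    by (auto simp: coords_def J_def)
  have B: "B \<in> sets (PiM (coords l j) law)"
    unfolding B_def using fin sets_forms_small by auto
  have "emeasure (PiM (coords l j \<union> J) law) S \<le> emeasure (PiM (coords l j) law) B + p ^ s"
  proof (rule emeasure_PiM_union_le[OF coords(2-4) _ B])
    show "S \<in> sets (PiM (coords l j \<union> J) law)"
      unfolding S_def coords(1)[symmetric] by (rule sets_forms_small[OF Suc.prems(1)])
    fix x assume x: "x \<in> space (PiM (coords l j) law)" "x \<notin> B"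
    define T where "T = tensor_entry n l (\<lambda>k i. x (k, i, j))"
    have "\<exists>v\<in>G a. \<eta> ^ l \<le> \<bar>\<Sum>q<n ^ l. v (q * n + r a) * T q\<bar>" if "a < s" for a
      using x that unfolding B_def forms_small_def slice_def T_def by (auto simp: not_less)
    then obtain v where v: "\<And>a. a < s \<Longrightarrow> v a \<in> G a"
      "\<And>a. a < s \<Longrightarrow> \<eta> ^ l \<le> \<bar>\<Sum>q<n ^ l. v a (q * n + r a) * T q\<bar>"
      by metis
    define c where "c a z = (\<Sum>q<n ^ l. v a (q * n + fst (snd z)) * T q)" for a and z :: "nat \<times> nat \<times> nat"
    have sumJ: "(\<Sum>z\<in>J. c a z * y z) = (\<Sum>i<n. (\<Sum>q<n ^ l. v a (q * n + i) * T q) * y (Suc l, i, j))" for a y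
      by (rule sum.reindex_bij_witness[of _ "\<lambda>i. (Suc l, i, j)" "\<lambda>z. fst (snd z)"]) (auto simp: J_def c_def)
    have "emeasure (PiM J law) ((\<lambda>y. merge (coords l j) J (x, y)) -` S \<inter> space (PiM J law)) \<le>
      emeasure (PiM J law) {y \<in> space (PiM J law). \<forall>a<s. \<bar>\<Sum>z\<in>J. c a z * y z\<bar> \<le> \<eta> ^ l * \<eta>}"
    proof (intro emeasure_mono subsetI)
      fix y assume y: "y \<in> (\<lambda>y. merge (coords l j) J (x, y)) -` S \<inter> space (PiM J law)"
      define xy where "xy = merge (coords l j) J (x, y)"
      have T: "tensor_entry n l (\<lambda>k i. xy (k, i, j)) q = T q" for q
        unfolding T_def using n_pos
        by (intro tensor_entry_cong) (auto simp: xy_def merge_def coords_def)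
      have last: "xy (Suc l, i, j) = y (Suc l, i, j)" if "i < n" for i
        using that by (simp add: xy_def merge_def coords_def J_def)
      have "\<bar>\<Sum>z\<in>J. c a z * y z\<bar> \<le> \<eta> ^ l * \<eta>" if a: "a < s" for a
      proof -
        have "v a \<in> F" using v(1)[OF a] G[OF a] by blast
        then have "\<bar>\<Sum>q<n ^ Suc l. v a q * tensor_entry n (Suc l) (\<lambda>k i. xy (k, i, j)) q\<bar> < \<eta> ^ Suc l"
          using y unfolding S_def forms_small_def xy_def by blast
        then show ?thesis
          unfolding tensor_inner_Suc T sumJ using last by (simp add: mult.commute)
      qed
      then show "y \<in> {y \<in> space (PiM J law). \<forall>a<s. \<bar>\<Sum>z\<in>J. c a z * y z\<bar> \<le> \<eta> ^ l * \<eta>}"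
        using y by simp
    qed measurable
    also have "\<dots> \<le> p ^ s"
    proof (rule emeasure_triangular_forms_le[OF coords(4), of "\<eta> ^ l" s "\<lambda>a. (Suc l, r a, j)"])
      show "(Suc l, r a, j) \<in> J \<and> \<eta> ^ l \<le> \<bar>c a (Suc l, r a, j)\<bar>" if "a < s" for a
        using r[OF that] v(2)[OF that] by (simp add: J_def c_def)
      show "c a (Suc l, r b, j) = 0" if "b < a" "a < s" for a b
        using vanish[OF that(2) v(1)[OF that(2)] that(1)] by (simp add: c_def)
    qed (use \<eta>_pos in simp)
    finally show "emeasure (PiM J law) ((\<lambda>y. merge (coords l j) J (x, y)) -` S \<inter> space (PiM J law)) \<le> p ^ s" .
  qed
  also have "emeasure (PiM (coords l j) law) B \<le> (\<Sum>a<s. emeasure (PiM (coords l j) law) (forms_small l j (slice a)))"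
    unfolding B_def by (rule emeasure_subadditive_finite) (use fin sets_forms_small in auto)
  also have "\<dots> \<le> (\<Sum>a<s. of_nat (l * s ^ l) * p ^ s)"
    by (intro sum_mono Suc.IH) (use fin tree in \<open>auto simp: slice_def\<close>)
  also have "(\<Sum>a<s. of_nat (l * s ^ l) * p ^ s) + p ^ s = of_nat (l * s ^ Suc l + 1) * p ^ s"
    by (simp add: algebra_simps)
  also have "\<dots> \<le> of_nat (Suc l * s ^ Suc l) * p ^ s"
    using assms(1) by (intro mult_right_mono of_nat_mono) auto
  finally show ?case unfolding S_def coords(1) by (simp add: add_right_mono)
qed

end

section \<open>Nearly dependent columns and the union bound\<close>

definition kr_entry :: "nat \<Rightarrow> nat \<Rightarrow> (nat \<times> nat \<times> nat \<Rightarrow> real) \<Rightarrow> nat \<Rightarrow> nat \<Rightarrow> real" where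
  "kr_entry n l x q j = tensor_entry n l (\<lambda>k i. x (k, i, j)) q"

text \<open>A certificate \<open>w\<close> for a smallest singular value below \<delta> (when
  \<delta> is positive), squared to be polynomial in the entries and strict to survive small changes
  of \<open>w\<close>.\<close>

definition small_image :: "nat \<Rightarrow> nat \<Rightarrow> real \<Rightarrow> (nat \<Rightarrow> nat \<Rightarrow> real) \<Rightarrow> (nat \<Rightarrow> real) \<Rightarrow> bool" where
  "small_image N R \<delta> B w \<longleftrightarrow> (\<Sum>q<N. (\<Sum>j<R. B q j * w j)\<^sup>2) < \<delta>\<^sup>2 * (\<Sum>j<R. (w j)\<^sup>2)"

context tensor_laws
begin

text \<open>Lists of rationals form a countable type, which keeps the existential measurable. Past
  the end of \<open>u\<close> the value \<open>u ! j\<close> is some fixed rational, so a short list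
  is still a legitimate vector.\<close>

definition ill_conditioned :: "nat \<Rightarrow> nat \<Rightarrow> real \<Rightarrow> (nat \<times> nat \<times> nat \<Rightarrow> real) set" where
  "ill_conditioned l R \<delta> = {x \<in> space (PiM ({1..l} \<times> {..<n} \<times> {..<R}) law).
     \<exists>u::rat list. small_image (n ^ l) R \<delta> (kr_entry n l x) (\<lambda>j. of_rat (u ! j))}"

text \<open>A dominant coordinate \<open>j\<close> turns smallness relative to the norm of
  \<open>u\<close> into smallness relative to \<open>u ! j\<close>, so it is column \<open>j\<close>
  that nearly lies in the span of the others.\<close>

definition ill_conditioned_at :: "nat \<Rightarrow> nat \<Rightarrow> real \<Rightarrow> nat \<Rightarrow> (nat \<times> nat \<times> nat \<Rightarrow> real) set" where
  "ill_conditioned_at l R \<delta> j = {x \<in> space (PiM ({1..l} \<times> {..<n} \<times> {..<R}) law).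
     \<exists>u::rat list. small_image (n ^ l) R \<delta> (kr_entry n l x) (\<lambda>j. of_rat (u ! j)) \<and>
       (\<forall>i<R. \<bar>u ! i\<bar> \<le> \<bar>u ! j\<bar>)}"

lemma kr_entry_measurable:
  assumes "j < R"
  shows "(\<lambda>x. kr_entry n l x q j) \<in> borel_measurable (PiM ({1..l} \<times> {..<n} \<times> {..<R}) law)"
  unfolding kr_entry_def
proof (rule tensor_entry_measurable)
  fix k i assume "k \<in> {1..l}" "i < n"
  with assms have [measurable]: "(k, i, j) \<in> {1..l} \<times> {..<n} \<times> {..<R}" by simp
  show "(\<lambda>x. x (k, i, j)) \<in> borel_measurable (PiM ({1..l} \<times> {..<n} \<times> {..<R}) law)" by measurable
qed

lemma small_image_measurable [measurable]:
  "Measurable.pred (PiM ({1..l} \<times> {..<n} \<times> {..<R}) law) (\<lambda>x. small_image N R \<delta> (kr_entry n l x) w)"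
proof -
  have [measurable]: "(\<lambda>x. (\<Sum>j<R. kr_entry n l x q j * w j)) \<in>
      borel_measurable (PiM ({1..l} \<times> {..<n} \<times> {..<R}) law)" for q
    by (intro borel_measurable_sum borel_measurable_times kr_entry_measurable) auto
  show ?thesis unfolding small_image_def by measurable
qed

lemma sets_ill_conditioned: "ill_conditioned l R \<delta> \<in> sets (PiM ({1..l} \<times> {..<n} \<times> {..<R}) law)"
  unfolding ill_conditioned_def by measurable

lemma sets_ill_conditioned_at: "ill_conditioned_at l R \<delta> j \<in> sets (PiM ({1..l} \<times> {..<n} \<times> {..<R}) law)"
  unfolding ill_conditioned_at_def by measurable

lemma ill_conditioned_subset: "ill_conditioned l R \<delta> \<subseteq> (\<Union>j<R. ill_conditioned_at l R \<delta> j)"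
proof
  fix x assume x: "x \<in> ill_conditioned l R \<delta>"
  then obtain u :: "rat list" where u: "small_image (n ^ l) R \<delta> (kr_entry n l x) (\<lambda>j. of_rat (u ! j))"
    unfolding ill_conditioned_def by blast
  have "0 < R" using u by (cases R) (auto simp: small_image_def)
  then have "finite ((\<lambda>j. \<bar>u ! j\<bar>) ` {..<R})" "(\<lambda>j. \<bar>u ! j\<bar>) ` {..<R} \<noteq> {}" by auto
  from Max_in[OF this] obtain j where j: "j < R" "Max ((\<lambda>j. \<bar>u ! j\<bar>) ` {..<R}) = \<bar>u ! j\<bar>" by auto
  have "\<bar>u ! i\<bar> \<le> \<bar>u ! j\<bar>" if "i < R" for i
    unfolding j(2)[symmetric] using that by (intro Max_ge) auto
  then show "x \<in> (\<Union>j<R. ill_conditioned_at l R \<delta> j)"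
    using x u j(1) unfolding ill_conditioned_at_def ill_conditioned_def by blast
qed

text \<open>Fixing the other columns fixes their annihilator and the tree while column
  \<open>j\<close> remains random. Testing the short vector \<open>b\<close> against a tree vector
  leaves \<open>w j\<close> times the inner product with column \<open>j\<close>. Of the two factors
  \<open>n ^ l\<close> in the condition on \<delta>, one counts the summands of this inner product
  and the other bounds \<open>R\<close>, which stands in for its square root.\<close>

lemma emeasure_ill_conditioned_at_le:
  assumes "1 \<le> s" "j < R" "R + l * ((s - 1) * n ^ (l - 1)) \<le> n ^ l" "0 < \<delta>"
    and \<delta>: "real (n ^ l) * real (n ^ l) * \<delta> \<le> \<eta> ^ l"
  shows "emeasure (PiM ({1..l} \<times> {..<n} \<times> {..<R}) law) (ill_conditioned_at l R \<delta> j) \<le> of_nat (l * s ^ l) * p ^ s"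
proof -
  define I where "I = {1..l} \<times> {..<n} \<times> ({..<R} - {j})"
  have U: "{1..l} \<times> {..<n} \<times> {..<R} = I \<union> coords l j" and disj: "I \<inter> coords l j = {}"
    and fin: "finite I" "finite (coords l j)"
    using assms(2) by (auto simp: I_def coords_def)
  have S: "ill_conditioned_at l R \<delta> j \<in> sets (PiM (I \<union> coords l j) law)"
    using sets_ill_conditioned_at[of l R \<delta> j] unfolding U .
  \<comment> \<open>The exceptional set is empty: every value of the other columns admits a
    tree.\<close>
  have "emeasure (PiM (I \<union> coords l j) law) (ill_conditioned_at l R \<delta> j) \<le>
    emeasure (PiM I law) {} + of_nat (l * s ^ l) * p ^ s"
  proof (rule emeasure_PiM_union_le[OF disj fin S])
    fix x assume x: "x \<in> space (PiM I law)"
    define C where "C = (\<lambda>i q. kr_entry n l x q i) ` ({..<R} - {j})"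
    define V where "V = {v. \<forall>c\<in>C. (\<Sum>q<n ^ l. c q * v q) = 0}"
    have "card C \<le> R - 1"
      unfolding C_def using card_image_le[of "{..<R} - {j}"] assms(2) by fastforce
    \<comment> \<open>Leaving out column \<open>j\<close> saves one equation, which gives the strict
      inequality that \<open>pivot_rich_annihilator\<close> asks for.\<close>
    then have "pivot_rich V (n ^ l) (l * ((s - 1) * n ^ (l - 1)))"
      unfolding V_def using assms(2,3) by (intro pivot_rich_annihilator) (auto simp: C_def)
    from echelon_tree_exists[OF add_0 assms(1) n_pos this]
    obtain F where F: "F \<subseteq> V" "finite F" "\<forall>v\<in>F. \<forall>q<n ^ l. \<bar>v q\<bar> \<le> 1" "echelon_tree s n l F"
      by auto
    have "emeasure (PiM (coords l j) law) ((\<lambda>y. merge I (coords l j) (x, y)) -` ill_conditioned_at l R \<delta> j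
        \<inter> space (PiM (coords l j) law)) \<le> emeasure (PiM (coords l j) law) (forms_small l j F)"
    proof (intro emeasure_mono subsetI sets_forms_small[OF F(2)])
      fix y assume y: "y \<in> (\<lambda>y. merge I (coords l j) (x, y)) -` ill_conditioned_at l R \<delta> j
        \<inter> space (PiM (coords l j) law)"
      define xy where "xy = merge I (coords l j) (x, y)"
      have "xy \<in> ill_conditioned_at l R \<delta> j" using y by (simp add: xy_def)
      then obtain u :: "rat list" where u: "small_image (n ^ l) R \<delta> (kr_entry n l xy) (\<lambda>j. of_rat (u ! j))"
        "\<forall>i<R. \<bar>u ! i\<bar> \<le> \<bar>u ! j\<bar>"
        unfolding ill_conditioned_at_def by blast
      define w where "w i = real_of_rat (u ! i)" for i
      define b where "b q = (\<Sum>i<R. kr_entry n l xy q i * w i)" for q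
      have w: "\<bar>w i\<bar> \<le> \<bar>w j\<bar>" if "i < R" for i
        using u(2) that by (simp add: w_def of_rat_less_eq)
      have "(\<Sum>q<n ^ l. (b q)\<^sup>2) < \<delta>\<^sup>2 * (\<Sum>i<R. (w i)\<^sup>2)"
        using u(1) by (simp add: small_image_def b_def w_def)
      also have "(\<Sum>i<R. (w i)\<^sup>2) \<le> (\<Sum>i<R. (w j)\<^sup>2)"
        using w by (intro sum_mono) (simp add: abs_le_square_iff)
      also have "\<delta>\<^sup>2 * (\<Sum>i<R. (w j)\<^sup>2) \<le> (\<delta> * real R * \<bar>w j\<bar>)\<^sup>2"
      proof -
        have "real R \<le> (real R)\<^sup>2" using assms(2) by (simp add: power2_eq_square flip: of_nat_mult)
        then have "\<delta>\<^sup>2 * (real R * (w j)\<^sup>2) \<le> \<delta>\<^sup>2 * ((real R)\<^sup>2 * (w j)\<^sup>2)"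
          by (intro mult_left_mono mult_right_mono) auto
        then show ?thesis by (simp add: power_mult_distrib)
      qed
      finally have sum_b: "(\<Sum>q<n ^ l. (b q)\<^sup>2) < (\<delta> * real R * \<bar>w j\<bar>)\<^sup>2"
        by (simp add: mult_left_mono)
      have b: "\<bar>b q\<bar> < \<delta> * real R * \<bar>w j\<bar>" if "q < n ^ l" for q
      proof (rule power2_less_imp_less)
        have "(b q)\<^sup>2 \<le> (\<Sum>q<n ^ l. (b q)\<^sup>2)" using that by (intro member_le_sum) auto
        then show "\<bar>b q\<bar>\<^sup>2 < (\<delta> * real R * \<bar>w j\<bar>)\<^sup>2" using sum_b by simp
      qed (use assms(4) in simp)
      \<comment> \<open>Strictness of \<open>small_image\<close> excludes a zero here, so
        \<open>w j\<close> can be cancelled at the end.\<close>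
      have wj: "\<bar>w j\<bar> > 0" using sum_b sum_nonneg[of "{..<n ^ l}" "\<lambda>q. (b q)\<^sup>2"] by auto
      have "\<bar>\<Sum>q<n ^ l. v q * tensor_entry n l (\<lambda>k i. y (k, i, j)) q\<bar> < \<eta> ^ l" if v: "v \<in> F" for v
      proof -
        have T: "tensor_entry n l (\<lambda>k i. y (k, i, j)) q = kr_entry n l xy q j" for q
          unfolding kr_entry_def using n_pos
          by (intro tensor_entry_cong) (auto simp: xy_def merge_def coords_def I_def)
        have other: "kr_entry n l xy q i = kr_entry n l x q i" if "i < R" "i \<noteq> j" for q i
          unfolding kr_entry_def using n_pos that
          by (intro tensor_entry_cong) (auto simp: xy_def merge_def coords_def I_def)
        have orth: "(\<Sum>q<n ^ l. v q * kr_entry n l xy q i) = 0" if "i < R" "i \<noteq> j" for i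
          using F(1) v that unfolding V_def C_def by (auto simp: other mult.commute)
        have "(\<Sum>q<n ^ l. v q * b q) = (\<Sum>i<R. \<Sum>q<n ^ l. v q * kr_entry n l xy q i * w i)"
          unfolding b_def sum_distrib_left by (subst sum.swap) (simp add: mult.assoc)
        also have "\<dots> = (\<Sum>i<R. (\<Sum>q<n ^ l. v q * kr_entry n l xy q i) * w i)"
          by (simp add: sum_distrib_right)
        also have "\<dots> = (\<Sum>i\<in>{j}. (\<Sum>q<n ^ l. v q * kr_entry n l xy q i) * w i)"
          using assms(2) orth by (intro sum.mono_neutral_right) auto
        finally have eq: "(\<Sum>q<n ^ l. v q * b q) = (\<Sum>q<n ^ l. v q * kr_entry n l xy q j) * w j" by simp
        have "\<bar>\<Sum>q<n ^ l. v q * b q\<bar> \<le> (\<Sum>q<n ^ l. \<bar>v q\<bar> * \<bar>b q\<bar>)"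
          using sum_abs[of "\<lambda>q. v q * b q"] by (simp add: abs_mult)
        also have "\<dots> < (\<Sum>q<n ^ l. \<delta> * real R * \<bar>w j\<bar>)"
        proof (rule sum_strict_mono)
          show "\<bar>v q\<bar> * \<bar>b q\<bar> < \<delta> * real R * \<bar>w j\<bar>" if "q \<in> {..<n ^ l}" for q
          proof -
            have "\<bar>v q\<bar> * \<bar>b q\<bar> \<le> 1 * \<bar>b q\<bar>" using F(3) v that by (intro mult_right_mono) auto
            with b[of q] that show ?thesis by simp
          qed
        qed (use n_pos in \<open>auto simp: lessThan_empty_iff\<close>)
        also have "\<dots> = real (n ^ l) * real R * \<delta> * \<bar>w j\<bar>" by simp
        also have "\<dots> \<le> real (n ^ l) * real (n ^ l) * \<delta> * \<bar>w j\<bar>"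
          using assms(3,4) by (intro mult_right_mono mult_left_mono of_nat_mono) auto
        also have "\<dots> \<le> \<eta> ^ l * \<bar>w j\<bar>" by (intro mult_right_mono \<delta>) simp
        finally show ?thesis unfolding eq T abs_mult using wj by simp
      qed
      then show "y \<in> forms_small l j F" using y unfolding forms_small_def by blast
    qed
    also have "\<dots> \<le> of_nat (l * s ^ l) * p ^ s"
      by (rule emeasure_echelon_tree_small[OF assms(1) F(2,4)])
    finally show "emeasure (PiM (coords l j) law) ((\<lambda>y. merge I (coords l j) (x, y)) -` ill_conditioned_at l R \<delta> j
        \<inter> space (PiM (coords l j) law)) \<le> of_nat (l * s ^ l) * p ^ s" .
  qed simp
  then show ?thesis unfolding U by simp
qed

lemma emeasure_ill_conditioned_le:
  assumes "1 \<le> s" "R + l * ((s - 1) * n ^ (l - 1)) \<le> n ^ l" "0 < \<delta>"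
    and "real (n ^ l) * real (n ^ l) * \<delta> \<le> \<eta> ^ l"
  shows "emeasure (PiM ({1..l} \<times> {..<n} \<times> {..<R}) law) (ill_conditioned l R \<delta>) \<le> of_nat (R * (l * s ^ l)) * p ^ s"
proof -
  have "emeasure (PiM ({1..l} \<times> {..<n} \<times> {..<R}) law) (ill_conditioned l R \<delta>) \<le>
    emeasure (PiM ({1..l} \<times> {..<n} \<times> {..<R}) law) (\<Union>j<R. ill_conditioned_at l R \<delta> j)"
    using sets_ill_conditioned_at by (intro emeasure_mono ill_conditioned_subset) auto
  also have "\<dots> \<le> (\<Sum>j<R. emeasure (PiM ({1..l} \<times> {..<n} \<times> {..<R}) law) (ill_conditioned_at l R \<delta> j))"
    using sets_ill_conditioned_at by (intro emeasure_subadditive_finite) auto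
  also have "\<dots> \<le> (\<Sum>j<R. of_nat (l * s ^ l) * p ^ s)"
    using assms by (intro sum_mono emeasure_ill_conditioned_at_le) auto
  finally show ?thesis by (simp add: mult.assoc)
qed

end

section \<open>Spectra of Gram matrices and the robust Kruskal rank\<close>

text \<open>The Hermitian form \<open>Q\<close> of \<open>A\<close> at an eigenvector equals its own
  conjugate by symmetry, and it is also \<open>e\<close> times a positive number.\<close>

lemma symmetric_eigenvalue_real:
  fixes A :: "real mat"
  assumes A: "A \<in> carrier_mat R R" and sym: "\<And>i j. i < R \<Longrightarrow> j < R \<Longrightarrow> A $$ (i, j) = A $$ (j, i)"
    and ev: "eigenvalue (map_mat complex_of_real A) e"
  shows "e = complex_of_real (Re e)"
proof -
  obtain v where v: "v \<in> carrier_vec R" "v \<noteq> 0\<^sub>v R" "map_mat complex_of_real A *\<^sub>v v = e \<cdot>\<^sub>v v"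
    using ev A unfolding eigenvalue_def eigenvector_def by auto
  have row: "(\<Sum>j<R. of_real (A $$ (i, j)) * vec_index v j) = e * vec_index v i" if "i < R" for i
  proof -
    have "vec_index (map_mat complex_of_real A *\<^sub>v v) i = e * vec_index v i"
      using v that by simp
    then show ?thesis using A v(1) that by (simp add: scalar_prod_def atLeast0LessThan)
  qed
  define Q where "Q = (\<Sum>i<R. \<Sum>j<R. cnj (vec_index v i) * (of_real (A $$ (i, j)) * vec_index v j))"
  have "Q = (\<Sum>i<R. cnj (vec_index v i) * (e * vec_index v i))"
    unfolding Q_def by (intro sum.cong refl) (simp add: row flip: sum_distrib_left)
  also have "\<dots> = e * of_real (\<Sum>i<R. (norm (vec_index v i))\<^sup>2)"
    unfolding of_real_sum sum_distrib_left
    by (intro sum.cong refl) (simp add: complex_norm_square mult_ac del: of_real_power)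
  finally have Q: "Q = e * of_real (\<Sum>i<R. (norm (vec_index v i))\<^sup>2)" .
  have "cnj Q = (\<Sum>i<R. \<Sum>j<R. cnj (vec_index v j) * (of_real (A $$ (j, i)) * vec_index v i))"
    unfolding Q_def cnj_sum by (intro sum.cong refl) (simp add: sym mult_ac)
  also have "\<dots> = Q" unfolding Q_def by (rule sum.swap)
  finally have "Im Q = 0" by (simp add: complex_eq_iff)
  moreover obtain i where "i < R" "vec_index v i \<noteq> 0"
    using v(1,2) by (auto simp: vec_eq_iff)
  then have "(\<Sum>i<R. (norm (vec_index v i))\<^sup>2) \<noteq> 0"
    by (subst sum_nonneg_eq_0_iff) auto
  ultimately have "Im e = 0" unfolding Q by simp
  then show ?thesis by (simp add: complex_eq_iff)
qed

text \<open>The complex roots are real, so the complex linear factors are images of real ones, and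
  the embedding of polynomials is injective.\<close>

lemma symmetric_char_poly_splits:
  fixes A :: "real mat"
  assumes A: "A \<in> carrier_mat R R" and sym: "\<And>i j. i < R \<Longrightarrow> j < R \<Longrightarrow> A $$ (i, j) = A $$ (j, i)"
  obtains es where "char_poly A = (\<Prod>e\<leftarrow>es. [:- e, 1:])" "length es = R"
proof -
  interpret P: map_poly_inj_idom_hom complex_of_real ..
  let ?A = "map_mat complex_of_real A"
  have A': "?A \<in> carrier_mat R R" using A by simp
  obtain as where as: "char_poly ?A = (\<Prod>a\<leftarrow>as. [:- a, 1:])" "length as = R"
    using char_poly_factorized[OF A'] by blast
  have "complex_of_real (Re a) = a" if "a \<in> set as" for a
  proof -
    have "poly (char_poly ?A) a = 0" using that by (auto simp: as(1) poly_prod_list prod_list_zero_iff)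
    then show ?thesis
      using symmetric_eigenvalue_real[OF A sym] eigenvalue_root_char_poly[OF A'] by metis
  qed
  then have "map (\<lambda>a. [:- a, 1:]) as = map (\<lambda>e. map_poly complex_of_real [:- e, 1:]) (map Re as)"
    by (simp add: map_poly_pCons)
  then have "char_poly ?A = (\<Prod>e\<leftarrow>map Re as. map_poly complex_of_real [:- e, 1:])"
    unfolding as(1) by (rule arg_cong[of _ _ prod_list])
  also have "\<dots> = map_poly complex_of_real (\<Prod>e\<leftarrow>map Re as. [:- e, 1:])"
    by (simp only: P.hom_prod_list map_map o_def)
  finally have "map_poly complex_of_real (char_poly A) = map_poly complex_of_real (\<Prod>e\<leftarrow>map Re as. [:- e, 1:])"
    by (simp only: of_real_hom.char_poly_hom[OF A])
  then have "char_poly A = (\<Prod>e\<leftarrow>map Re as. [:- e, 1:])"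
    by (simp only: P.eq_iff)
  then show ?thesis using that[of "map Re as"] as(2) by simp
qed

lemma proots_prod_linear: "proots (\<Prod>e\<leftarrow>es. [:- e, 1:]) = mset (es :: real list)"
proof (induction es)
  case (Cons e es)
  have "(\<Prod>e\<leftarrow>es. [:- e, 1:]) \<noteq> 0" by (auto simp: prod_list_zero_iff)
  then have "proots ([:- e, 1:] * (\<Prod>e\<leftarrow>es. [:- e, 1:])) = {#e#} + mset es"
    by (subst proots_mult) (simp_all only: Cons.IH proots_linear_factor minus_minus, auto)
  then show ?case by (simp only: list.map prod_list.Cons mset.simps) simp
qed simp

text \<open>The last of \<open>R\<close> values in decreasing order is the head of
  \<open>ys\<close>, so bounding it bounds all. Since \<open>sqrt\<close> takes negative values at
  negative arguments, comparing with \<open>sqrt e\<close> amounts to comparing squares for every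
  real \<open>e\<close>.\<close>

lemma singular_value_ge_iff:
  assumes "char_poly (transpose_mat B * B) = (\<Prod>e\<leftarrow>es. [:- e, 1:])" "length es = R" "0 < R" "0 \<le> \<delta>"
  shows "\<delta> \<le> singular_value B R \<longleftrightarrow> (\<forall>e\<in>set es. \<delta>\<^sup>2 \<le> e)"
proof -
  define ys where "ys = sort (map sqrt es)"
  have "singular_values B = rev ys"
    unfolding singular_values_def assms(1) proots_prod_linear ys_def
    by (metis mset_map sorted_list_of_multiset_mset)
  moreover have len: "length ys = R" using assms(2) by (simp add: ys_def)
  ultimately have "singular_value B R = ys ! 0"
    using assms(3) by (simp add: singular_value_def rev_nth)
  moreover obtain y ys' where y: "ys = y # ys'" using len assms(3) by (cases ys) auto
  moreover have "sorted ys" by (simp add: ys_def)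
  ultimately have "\<delta> \<le> singular_value B R \<longleftrightarrow> (\<forall>x\<in>set ys. \<delta> \<le> x)" by auto
  also have "\<dots> \<longleftrightarrow> (\<forall>e\<in>set es. \<delta> \<le> sqrt e)" by (simp add: ys_def)
  also have "\<dots> \<longleftrightarrow> (\<forall>e\<in>set es. \<delta>\<^sup>2 \<le> e)"
    using real_le_rsqrt[of \<delta>] sqrt_ge_absD[of \<delta>] assms(4) by (intro ball_cong) auto
  finally show ?thesis .
qed

text \<open>Only the full set of columns has \<open>R\<close> elements, and it selects
  \<open>B\<close> itself.\<close>

lemma robust_krank_eq_dim_col_iff:
  assumes B: "B \<in> carrier_mat N R"
  shows "robust_krank \<tau> B = R \<longleftrightarrow> R = 0 \<or> 1 / \<tau> \<le> singular_value B R"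
proof -
  define K where "K = {k. k \<le> dim_col B \<and> (k = 0 \<or> (\<forall>S. S \<subseteq> {..<dim_col B} \<and> card S = k \<longrightarrow>
        singular_value (submatrix B UNIV S) k \<ge> 1 / \<tau>))}"
  have "finite K" by (rule finite_subset[of _ "{..dim_col B}"]) (auto simp: K_def)
  moreover have "0 \<in> K" by (simp add: K_def)
  moreover have "k \<le> R" if "k \<in> K" for k using that B by (simp add: K_def)
  ultimately have "Max K = R \<longleftrightarrow> R \<in> K"
    by (metis Max_eqI Max_in empty_iff)
  moreover have all: "(\<forall>S. S \<subseteq> {..<R} \<and> card S = R \<longrightarrow> P S) \<longleftrightarrow> P {..<R}" for P
    using card_subset_eq[of "{..<R}"] by (metis card_lessThan finite_lessThan order_refl)
  have sub: "submatrix B UNIV {..<R} = B"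
  proof (rule eq_matI)
    fix i j assume ij: "i < dim_row B" "j < dim_col B"
    have "{a \<in> {..<R}. a < j} = {..<j}" using ij B by auto
    then have "pick {..<R} j = j" using pick_card_in_set[of j "{..<R}"] ij B by simp
    then show "submatrix B UNIV {..<R} $$ (i, j) = B $$ (i, j)"
      using ij B by (subst submatrix_index) (auto simp: pick_UNIV Collect_conj_eq[symmetric])
  qed (use B in \<open>auto simp: dim_submatrix\<close>)
  have "R \<in> K \<longleftrightarrow> R = 0 \<or> 1 / \<tau> \<le> singular_value B R"
    using B by (simp add: K_def all sub)
  ultimately have "Max K = R \<longleftrightarrow> R = 0 \<or> 1 / \<tau> \<le> singular_value B R" by simp
  then show ?thesis by (simp add: robust_krank_def K_def)
qed

lemma gram_symmetric:
  assumes "B \<in> carrier_mat N R" "i < R" "j < R"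
  shows "(transpose_mat B * B) $$ (i, j) = (\<Sum>q<N. B $$ (q, i) * B $$ (q, j))"
  using assms by (simp add: scalar_prod_def atLeast0LessThan)

lemma robust_krank_eq_dim_col_iff_eigenvalues:
  assumes B: "B \<in> carrier_mat N R" and "0 < \<tau>"
  obtains es where "char_poly (transpose_mat B * B) = (\<Prod>e\<leftarrow>es. [:- e, 1:])" "length es = R"
    "robust_krank \<tau> B = R \<longleftrightarrow> (\<forall>e\<in>set es. (1 / \<tau>)\<^sup>2 \<le> e)"
proof -
  have G: "transpose_mat B * B \<in> carrier_mat R R" using B by simp
  obtain es where es: "char_poly (transpose_mat B * B) = (\<Prod>e\<leftarrow>es. [:- e, 1:])" "length es = R"
    by (rule symmetric_char_poly_splits[OF G]) (simp_all add: gram_symmetric[OF B] mult.commute)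
  moreover have "robust_krank \<tau> B = R \<longleftrightarrow> (\<forall>e\<in>set es. (1 / \<tau>)\<^sup>2 \<le> e)"
    using singular_value_ge_iff[OF es, of "1 / \<tau>"] es(2) assms(2)
    unfolding robust_krank_eq_dim_col_iff[OF B] by (cases "R = 0") auto
  ultimately show ?thesis using that by blast
qed

text \<open>The inequality is strict and both sides are continuous in \<open>w\<close>, so it
  persists at rational vectors close to \<open>w\<close>.\<close>

lemma small_image_rational:
  assumes "small_image N R \<delta> B w"
  shows "\<exists>u::rat list. small_image N R \<delta> B (\<lambda>j. of_rat (u ! j))"
proof -
  have "\<exists>r::rat. \<bar>of_rat r - w j\<bar> < 1 / real (Suc m)" for m j
  proof -
    obtain q where "w j < of_rat q" "of_rat q < w j + 1 / real (Suc m)"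
      using of_rat_dense[of "w j" "w j + 1 / real (Suc m)"] by auto
    then show ?thesis by (intro exI[of _ q]) simp
  qed
  then have "\<forall>m. \<exists>r. \<forall>j. \<bar>of_rat (r j) - w j\<bar> < 1 / real (Suc m)" by (intro allI choice)
  then obtain r :: "nat \<Rightarrow> nat \<Rightarrow> rat" where r: "\<And>m j. \<bar>of_rat (r m j) - w j\<bar> < 1 / real (Suc m)"
    using choice[of "\<lambda>m r. \<forall>j. \<bar>of_rat (r j) - w j\<bar> < 1 / real (Suc m)"] by blast
  have lim: "(\<lambda>m. of_rat (r m j)) \<longlonglongrightarrow> w j" for j
  proof (rule LIM_zero_cancel, rule Lim_null_comparison)
    show "\<forall>\<^sub>F m in sequentially. norm (of_rat (r m j) - w j) \<le> 1 / real (Suc m)"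
      using r by (intro always_eventually) (auto intro: less_imp_le)
    show "(\<lambda>m. 1 / real (Suc m)) \<longlonglongrightarrow> 0" using LIMSEQ_inverse_real_of_nat by (simp add: inverse_eq_divide)
  qed
  define D where "D v = \<delta>\<^sup>2 * (\<Sum>j<R. (v j)\<^sup>2) - (\<Sum>q<N. (\<Sum>j<R. B q j * v j)\<^sup>2)" for v :: "nat \<Rightarrow> real"
  have "(\<lambda>m. D (\<lambda>j. of_rat (r m j))) \<longlonglongrightarrow> D w"
    unfolding D_def by (intro tendsto_intros lim)
  moreover have "0 < D w" using assms by (simp add: small_image_def D_def)
  ultimately have "\<forall>\<^sub>F m in sequentially. 0 < D (\<lambda>j. of_rat (r m j))" by (rule order_tendstoD(1))
  then obtain m where "0 < D (\<lambda>j. of_rat (r m j))" by (auto simp: eventually_sequentially)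
  then have "small_image N R \<delta> B (\<lambda>j. of_rat (map (r m) [0..<R] ! j))"
    by (simp add: small_image_def D_def)
  then show ?thesis by blast
qed

text \<open>Some eigenvalue \<open>e\<close> of the Gram matrix lies below the square of 1/\<tau>,
  and at an eigenvector \<open>v\<close> the squared norm of the image is exactly \<open>e\<close>
  times that of \<open>v\<close>.\<close>

lemma robust_krank_deficient_small_image:
  assumes B: "B \<in> carrier_mat N R" and "0 < \<tau>" "robust_krank \<tau> B \<noteq> R"
  shows "\<exists>u::rat list. small_image N R (1 / \<tau>) (\<lambda>q j. B $$ (q, j)) (\<lambda>j. of_rat (u ! j))"
proof -
  let ?G = "transpose_mat B * B"
  have G: "?G \<in> carrier_mat R R" using B by simp
  obtain es where es: "char_poly ?G = (\<Prod>e\<leftarrow>es. [:- e, 1:])" "length es = R"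
    "robust_krank \<tau> B = R \<longleftrightarrow> (\<forall>e\<in>set es. (1 / \<tau>)\<^sup>2 \<le> e)"
    by (rule robust_krank_eq_dim_col_iff_eigenvalues[OF B assms(2)])
  then obtain e where e: "e \<in> set es" "e < (1 / \<tau>)\<^sup>2" using assms(3) by force
  have "poly (char_poly ?G) e = 0" using e by (auto simp: es(1) poly_prod_list prod_list_zero_iff)
  then have "eigenvalue ?G e" using eigenvalue_root_char_poly[OF G] by blast
  then obtain v where v: "v \<in> carrier_vec R" "v \<noteq> 0\<^sub>v R" "?G *\<^sub>v v = e \<cdot>\<^sub>v v"
    using B unfolding eigenvalue_def eigenvector_def by auto
  have Bv: "B *\<^sub>v v \<in> carrier_vec N" using B v by simp
  have "(B *\<^sub>v v) \<bullet> (B *\<^sub>v v) = (transpose_mat B *\<^sub>v (B *\<^sub>v v)) \<bullet> v"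
    using transpose_vec_mult_scalar[OF B v(1) Bv] by simp
  also have "transpose_mat B *\<^sub>v (B *\<^sub>v v) = e \<cdot>\<^sub>v v"
    using B v assoc_mult_mat_vec[of "transpose_mat B" R N B R v] by simp
  finally have eq: "(B *\<^sub>v v) \<bullet> (B *\<^sub>v v) = e * (v \<bullet> v)" using v(1) by simp
  have "(B *\<^sub>v v) \<bullet> (B *\<^sub>v v) = (\<Sum>q<N. (\<Sum>j<R. B $$ (q, j) * vec_index v j)\<^sup>2)"
    using B v(1) by (simp add: scalar_prod_def atLeast0LessThan power2_eq_square)
  moreover have vv: "v \<bullet> v = (\<Sum>j<R. (vec_index v j)\<^sup>2)"
    using v(1) by (simp add: scalar_prod_def atLeast0LessThan power2_eq_square)
  moreover have "0 < v \<bullet> v"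
  proof -
    obtain i where "i < R" "vec_index v i \<noteq> 0" using v(1,2) by (auto simp: vec_eq_iff)
    then show ?thesis unfolding vv by (intro sum_pos2[of _ i]) auto
  qed
  ultimately have "small_image N R (1 / \<tau>) (\<lambda>q j. B $$ (q, j)) (vec_index v)"
    using mult_strict_right_mono[OF e(2), of "v \<bullet> v"] eq unfolding small_image_def by simp
  then show ?thesis by (rule small_image_rational)
qed

text \<open>
  Makes the event measurable: the characteristic polynomial is a polynomial in the entries, and
  countably many conditions on its values suffice.
\<close>

lemma all_ge_iff_rational_poly_bound:
  fixes c :: real
  shows "(\<forall>e\<in>set es. c \<le> e) \<longleftrightarrow> (\<forall>r::rat. of_rat r < c \<longrightarrow>
    (c - of_rat r) ^ length es \<le> \<bar>poly (\<Prod>e\<leftarrow>es. [:- e, 1:]) (of_rat r)\<bar>)"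
proof
  assume ge: "\<forall>e\<in>set es. c \<le> e"
  show "\<forall>r::rat. of_rat r < c \<longrightarrow>
    (c - of_rat r) ^ length es \<le> \<bar>poly (\<Prod>e\<leftarrow>es. [:- e, 1:]) (of_rat r)\<bar>"
  proof (intro allI impI)
    fix r :: rat assume r: "of_rat r < c"
    show "(c - of_rat r) ^ length es \<le> \<bar>poly (\<Prod>e\<leftarrow>es. [:- e, 1:]) (of_rat r)\<bar>"
      using ge
    proof (induction es)
      case (Cons e es)
      have "(c - of_rat r) * (c - of_rat r) ^ length es \<le> \<bar>of_rat r - e\<bar> * \<bar>poly (\<Prod>e\<leftarrow>es. [:- e, 1:]) (of_rat r)\<bar>"
        using Cons r by (intro mult_mono) auto
      then show ?case by (simp only: list.map prod_list.Cons poly_mult abs_mult list.size power_Suc add_0_right power_add power_one_right add.commute) (simp add: abs_minus_commute)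
    qed simp
  qed
next
  assume bound: "\<forall>r::rat. of_rat r < c \<longrightarrow>
    (c - of_rat r) ^ length es \<le> \<bar>poly (\<Prod>e\<leftarrow>es. [:- e, 1:]) (of_rat r)\<bar>"
  show "\<forall>e\<in>set es. c \<le> e"
  proof (intro ballI, rule ccontr)
    fix e assume e: "e \<in> set es" "\<not> c \<le> e"
    \<comment> \<open>At a root below \<open>c\<close> the polynomial vanishes while the power of
      \<open>c - x\<close> is positive; by continuity a rational point next to the root violates the
      bound.\<close>
    define f where "f x = (c - x) ^ length es - \<bar>poly (\<Prod>e\<leftarrow>es. [:- e, 1:]) x\<bar>" for x
    have "poly (\<Prod>e\<leftarrow>es. [:- e, 1:]) e = 0" using e by (auto simp: poly_prod_list prod_list_zero_iff)
    then have "0 < f e" using e by (simp add: f_def)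
    have "open {x. 0 < f x \<and> x < c}"
      unfolding f_def by (intro open_Collect_conj open_Collect_less continuous_intros)
    moreover have "e \<in> {x. 0 < f x \<and> x < c}" using \<open>0 < f e\<close> e by simp
    ultimately obtain d where d: "d > 0" "ball e d \<subseteq> {x. 0 < f x \<and> x < c}" by (rule openE)
    obtain r where "e < of_rat r" "of_rat r < e + d" using of_rat_dense[of e "e + d"] d by auto
    then have "of_rat r \<in> ball e d" by (simp add: dist_real_def)
    then have "0 < f (of_rat r)" "of_rat r < c" using d by auto
    then show False using bound by (auto simp: f_def)
  qed
qed

text \<open>Indispensable for a lower bound on the probability, because \<open>measure\<close> is 0
  on sets that are not measurable.\<close>

lemma sets_robust_krank_eq:
  fixes B :: "'w \<Rightarrow> real mat"
  assumes B: "\<And>\<omega>. \<omega> \<in> space M \<Longrightarrow> B \<omega> \<in> carrier_mat N R" and "0 < \<tau>"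
    and meas: "\<And>q j. q < N \<Longrightarrow> j < R \<Longrightarrow> (\<lambda>\<omega>. B \<omega> $$ (q, j)) \<in> borel_measurable M"
  shows "{\<omega> \<in> space M. robust_krank \<tau> (B \<omega>) = R} \<in> sets M"
proof -
  \<comment> \<open>The Leibniz expansion of the determinant of \<open>r\<close> times the identity
    minus the Gram matrix.\<close>
  define D where "D r \<omega> = (\<Sum>p | p permutes {0..<R}. signof p *
    (\<Prod>i = 0..<R. (if i = p i then r else 0) - (\<Sum>q<N. B \<omega> $$ (q, i) * B \<omega> $$ (q, p i))))" for r :: real and \<omega>
  have D: "poly (char_poly (transpose_mat (B \<omega>) * B \<omega>)) r = D r \<omega>" if "\<omega> \<in> space M" for \<omega> r
  proof -
    let ?G = "transpose_mat (B \<omega>) * B \<omega>"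
    have G: "?G \<in> carrier_mat R R" using B[OF that] by simp
    have entry: "(- char_matrix ?G r) $$ (i, p i) = (if i = p i then r else 0) - (\<Sum>q<N. B \<omega> $$ (q, i) * B \<omega> $$ (q, p i))"
      if "p permutes {0..<R}" "i \<in> {0..<R}" for p i
    proof -
      have "i < R" "p i < R" using that permutes_in_image[OF that(1), of i] by auto
      then show ?thesis
        using G B[OF \<open>\<omega> \<in> space M\<close>] gram_symmetric[OF B[OF \<open>\<omega> \<in> space M\<close>], of i "p i"]
        by (auto simp: char_matrix_def)
    qed
    have "- char_matrix ?G r \<in> carrier_mat R R" using G by simp
    then show ?thesis
      unfolding char_poly_matrix[OF G] D_def by (subst det_def') (auto intro!: sum.cong prod.cong simp: entry)
  qed
  have D_meas: "D r \<in> borel_measurable M" for r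
    unfolding D_def
    by (intro borel_measurable_sum borel_measurable_times borel_measurable_const borel_measurable_prod
        borel_measurable_diff meas) (auto simp: permutes_in_image dest: permutes_in_image)
  have iff: "robust_krank \<tau> (B \<omega>) = R \<longleftrightarrow> (\<forall>r::rat. of_rat r < (1 / \<tau>)\<^sup>2 \<longrightarrow>
      ((1 / \<tau>)\<^sup>2 - of_rat r) ^ R \<le> \<bar>D (of_rat r) \<omega>\<bar>)" if \<omega>: "\<omega> \<in> space M" for \<omega>
  proof -
    obtain es where es: "char_poly (transpose_mat (B \<omega>) * B \<omega>) = (\<Prod>e\<leftarrow>es. [:- e, 1:])" "length es = R"
      "robust_krank \<tau> (B \<omega>) = R \<longleftrightarrow> (\<forall>e\<in>set es. (1 / \<tau>)\<^sup>2 \<le> e)"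
      by (rule robust_krank_eq_dim_col_iff_eigenvalues[OF B[OF \<omega>] assms(2)])
    show ?thesis unfolding es(3) all_ge_iff_rational_poly_bound es(1)[symmetric] D[OF \<omega>] es(2) ..
  qed
  have "{\<omega> \<in> space M. robust_krank \<tau> (B \<omega>) = R} = {\<omega> \<in> space M. \<forall>r::rat. of_rat r < (1 / \<tau>)\<^sup>2 \<longrightarrow>
      ((1 / \<tau>)\<^sup>2 - of_rat r) ^ R \<le> \<bar>D (of_rat r) \<omega>\<bar>}"
    using iff by auto
  also have "\<dots> \<in> sets M" using D_meas by measurable
  finally show ?thesis .
qed

section \<open>Entries of the iterated Khatri-Rao product\<close>

lemma khatri_rao_prod_Suc:
  "1 \<le> l \<Longrightarrow> khatri_rao_prod (Suc l) X = khatri_rao (khatri_rao_prod l X) (X (Suc l))"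
  by (simp add: khatri_rao_prod_def numeral_2_eq_2 del: upt_Suc) (simp add: upt_Suc)

text \<open>The product is nested to the left, so \<open>tensor_vec\<close> reads the newest factor
  at \<open>q mod n\<close> and the earlier ones at \<open>q div n\<close>, which is the recursion
  of \<open>tensor_entry\<close>.\<close>

lemma khatri_rao_prod_entries:
  assumes "1 \<le> l" "1 \<le> n" "\<And>k. k \<in> {1..l} \<Longrightarrow> X k \<in> carrier_mat n R"
  shows "khatri_rao_prod l X \<in> carrier_mat (n ^ l) R \<and> (\<forall>q<n ^ l. \<forall>j<R.
    khatri_rao_prod l X $$ (q, j) = tensor_entry n l (\<lambda>k i. X k $$ (i, j)) q)"
  using assms(1,3)
proof (induction l rule: dec_induct)
  case base
  then show ?case by (auto simp: khatri_rao_prod_def)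
next
  case (step l)
  let ?P = "khatri_rao_prod l X" and ?X = "X (Suc l)"
  have IH: "?P \<in> carrier_mat (n ^ l) R"
    "\<And>q j. q < n ^ l \<Longrightarrow> j < R \<Longrightarrow> ?P $$ (q, j) = tensor_entry n l (\<lambda>k i. X k $$ (i, j)) q"
    using step by auto
  have X: "?X \<in> carrier_mat n R" using step.prems by simp
  have carrier: "khatri_rao ?P ?X \<in> carrier_mat (n ^ l * n) R"
    using IH(1) X by (auto simp: khatri_rao_def)
  have "khatri_rao ?P ?X $$ (q, j) = tensor_entry n (Suc l) (\<lambda>k i. X k $$ (i, j)) q"
    if q: "q < n ^ l * n" and j: "j < R" for q j
  proof -
    have div: "q div n < n ^ l" using q by (rule less_mult_imp_div_less)
    have mod: "q mod n < n" using assms(2) by simp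
    have "khatri_rao ?P ?X $$ (q, j) = vec_index (tensor_vec (col ?P j) (col ?X j)) q"
      using IH(1) X q j by (simp add: khatri_rao_def mat_of_cols_index)
    also have "\<dots> = ?P $$ (q div n, j) * ?X $$ (q mod n, j)"
      using IH(1) X q j div mod by (simp add: tensor_vec_def)
    finally show ?thesis using IH(2)[OF div j] by simp
  qed
  with carrier show ?case unfolding khatri_rao_prod_Suc[OF step.hyps(1)] power_Suc2 by blast
qed

section \<open>Comparison of Gaussian and uniform laws\<close>

text \<open>One factor \<beta> is lost per coordinate. Integrals are compared rather than measures
  of sets because the inner integral \<open>g\<close> of Fubini is no longer an indicator.\<close>

lemma nn_integral_PiM_ge:
  fixes P Q :: "'i \<Rightarrow> real measure"
  assumes P: "\<And>i. prob_space (P i)" "\<And>i. sets (P i) = sets borel"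
    and Q: "\<And>i. prob_space (Q i)" "\<And>i. sets (Q i) = sets borel"
    and dom: "\<And>i f. f \<in> borel_measurable borel \<Longrightarrow> \<beta> * (\<integral>\<^sup>+x. f x \<partial>Q i) \<le> (\<integral>\<^sup>+x. f x \<partial>P i)"
    and "finite I" "f \<in> borel_measurable (PiM I P)"
  shows "\<beta> ^ card I * (\<integral>\<^sup>+x. f x \<partial>PiM I Q) \<le> (\<integral>\<^sup>+x. f x \<partial>PiM I P)"
  using assms(6,7)
proof (induction I arbitrary: f rule: finite_induct)
  case empty
  then show ?case by (simp add: PiM_empty)
next
  case (insert i I)
  interpret P: product_sigma_finite P
    by (intro product_sigma_finite.intro prob_space_imp_sigma_finite P)
  interpret Q: product_sigma_finite Q
    by (intro product_sigma_finite.intro prob_space_imp_sigma_finite Q)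
  note [measurable_cong] = P(2) Q(2)
  have sets_eq: "sets (PiM J P) = sets (PiM J Q)" for J
    by (intro sets_PiM_cong) (simp_all add: P Q)
  have fP[measurable]: "f \<in> borel_measurable (PiM (insert i I) P)" by fact
  have fQ[measurable]: "f \<in> borel_measurable (PiM (insert i I) Q)"
    using fP measurable_cong_sets[OF sets_eq refl] by blast
  have upd: "(\<lambda>y. f (x(i := y))) \<in> borel_measurable borel" if "x \<in> space (PiM I P)" for x
  proof -
    have "(\<lambda>y. x(i := y)) \<in> measurable (P i) (PiM (insert i I) P)"
      using measurable_component_update[OF that insert.hyps(2)] .
    from measurable_compose[OF this fP] show ?thesis
      using measurable_cong_sets[OF P(2) refl] by blast
  qed
  define g where "g x = (\<integral>\<^sup>+y. f (x(i := y)) \<partial>Q i)" for x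
  have "(\<lambda>(x, y). f (x(i := y))) \<in> borel_measurable (PiM I Q \<Otimes>\<^sub>M Q i)"
    using measurable_compose[OF measurable_add_dim fQ] by (simp add: case_prod_unfold)
  then have "g \<in> borel_measurable (PiM I Q)"
    unfolding g_def
    by (rule sigma_finite_measure.borel_measurable_nn_integral[OF prob_space_imp_sigma_finite[OF Q(1)]])
  then have g: "g \<in> borel_measurable (PiM I P)"
    using measurable_cong_sets[OF sets_eq refl] by blast
  have "\<beta> ^ card (insert i I) * (\<integral>\<^sup>+x. f x \<partial>PiM (insert i I) Q) = \<beta> * (\<beta> ^ card I * (\<integral>\<^sup>+x. g x \<partial>PiM I Q))"
    using insert.hyps Q.product_nn_integral_insert[OF insert.hyps fQ] by (simp add: g_def mult.assoc)
  also have "\<dots> \<le> \<beta> * (\<integral>\<^sup>+x. g x \<partial>PiM I P)"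
    by (intro mult_left_mono insert.IH g) simp
  also have "\<dots> = (\<integral>\<^sup>+x. \<beta> * g x \<partial>PiM I P)" using g by (simp add: nn_integral_cmult)
  also have "\<dots> \<le> (\<integral>\<^sup>+x. \<integral>\<^sup>+y. f (x(i := y)) \<partial>P i \<partial>PiM I P)"
    unfolding g_def by (intro nn_integral_mono dom upd)
  also have "\<dots> = (\<integral>\<^sup>+x. f x \<partial>PiM (insert i I) P)"
    using P.product_nn_integral_insert[OF insert.hyps fP] by simp
  finally show ?case .
qed

text \<open>The peak is rounded up through \<open>2 \<le> sqrt (2 * pi)\<close>, so that an interval
  of length 2 \<eta> gets mass at most \<eta>/\<sigma>.\<close>

lemma normal_density_le:
  assumes "0 < \<sigma>"
  shows "normal_density \<mu> \<sigma> x \<le> 1 / (2 * \<sigma>)"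
proof -
  have "2 \<le> sqrt (2 * pi)" using pi_gt3 by (intro real_le_rsqrt) simp
  then have "2 * \<sigma> \<le> sqrt (2 * pi * \<sigma>\<^sup>2)"
    using assms by (simp add: real_sqrt_mult)
  then have "1 / sqrt (2 * pi * \<sigma>\<^sup>2) \<le> 1 / (2 * \<sigma>)" using assms by (intro divide_left_mono) auto
  moreover have "exp (- (x - \<mu>)\<^sup>2 / (2 * \<sigma>\<^sup>2)) \<le> 1" by simp
  ultimately show ?thesis
    unfolding normal_density_def using assms
    by (meson exp_ge_zero mult_left_le order_trans real_sqrt_ge_zero zero_le_divide_1_iff
        mult_nonneg_nonneg pi_ge_zero zero_le_numeral zero_le_power2)
qed

lemma normal_small_ball:
  assumes "0 < \<sigma>" "0 \<le> \<eta>"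
  shows "emeasure (density lborel (normal_density \<mu> \<sigma>)) {c - \<eta>..c + \<eta>} \<le> ennreal (\<eta> / \<sigma>)"
proof -
  have "emeasure (density lborel (normal_density \<mu> \<sigma>)) {c - \<eta>..c + \<eta>} =
    (\<integral>\<^sup>+x. ennreal (normal_density \<mu> \<sigma> x) * indicator {c - \<eta>..c + \<eta>} x \<partial>lborel)"
    by (simp add: emeasure_density)
  also have "\<dots> \<le> (\<integral>\<^sup>+x. ennreal (1 / (2 * \<sigma>)) * indicator {c - \<eta>..c + \<eta>} x \<partial>lborel)"
    using assms by (intro nn_integral_mono mult_right_mono ennreal_leI normal_density_le) auto
  also have "\<dots> = ennreal (1 / (2 * \<sigma>)) * emeasure lborel {c - \<eta>..c + \<eta>}"
    by (simp add: nn_integral_cmult_indicator)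
  also have "\<dots> = ennreal (\<eta> / \<sigma>)"
    using assms by (simp flip: ennreal_mult')
  finally show ?thesis .
qed

definition centred_uniform :: "real \<Rightarrow> real \<Rightarrow> real measure" where
  "centred_uniform \<mu> r = uniform_measure lborel {\<mu> - r..\<mu> + r}"

lemma prob_space_centred_uniform: "0 < r \<Longrightarrow> prob_space (centred_uniform \<mu> r)"
  unfolding centred_uniform_def by (intro prob_space_uniform_measure) auto

lemma sets_centred_uniform [simp]: "sets (centred_uniform \<mu> r) = sets borel"
  by (simp add: centred_uniform_def)

lemma centred_uniform_small_ball:
  assumes "0 < r" "0 \<le> \<eta>"
  shows "emeasure (centred_uniform \<mu> r) {c - \<eta>..c + \<eta>} \<le> ennreal (\<eta> / r)"
proof -
  have "emeasure (centred_uniform \<mu> r) {c - \<eta>..c + \<eta>} =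
      emeasure lborel ({\<mu> - r..\<mu> + r} \<inter> {c - \<eta>..c + \<eta>}) / emeasure lborel {\<mu> - r..\<mu> + r}"
    unfolding centred_uniform_def by (rule emeasure_uniform_measure) auto
  also have "\<dots> \<le> emeasure lborel {c - \<eta>..c + \<eta>} / emeasure lborel {\<mu> - r..\<mu> + r}"
    by (intro divide_right_mono_ennreal emeasure_mono) auto
  also have "\<dots> = ennreal (\<eta> / r)" using assms by (simp add: divide_ennreal)
  finally show ?thesis .
qed

text \<open>On the interval the Gaussian density is at least its value at the endpoints. The ratio
  of that value to the uniform density depends on \<open>K\<close> alone, so the comparison is
  uniform in \<mu> and \<sigma>.\<close>

lemma normal_ge_centred_uniform:
  assumes "0 < \<sigma>" "0 < K" and f: "f \<in> borel_measurable borel"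
  shows "ennreal (2 * K * exp (- K\<^sup>2 / 2) / sqrt (2 * pi)) * (\<integral>\<^sup>+x. f x \<partial>centred_uniform \<mu> (K * \<sigma>)) \<le>
    (\<integral>\<^sup>+x. f x \<partial>density lborel (normal_density \<mu> \<sigma>))"
proof -
  let ?I = "{\<mu> - K * \<sigma>..\<mu> + K * \<sigma>}"
  define \<beta> where "\<beta> = 2 * K * exp (- K\<^sup>2 / 2) / sqrt (2 * pi)"
  have \<beta>: "0 \<le> \<beta>" using assms by (simp add: \<beta>_def)
  have c: "0 < 2 * K * \<sigma>" using assms by simp
  have dens: "\<beta> / (2 * K * \<sigma>) \<le> normal_density \<mu> \<sigma> x" if "x \<in> ?I" for x
  proof -
    have "\<bar>x - \<mu>\<bar> \<le> K * \<sigma>" using that by (auto simp: abs_le_iff)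
    then have "(x - \<mu>)\<^sup>2 \<le> (K * \<sigma>)\<^sup>2" using abs_le_square_iff[of "x - \<mu>" "K * \<sigma>"] assms by simp
    then have "- K\<^sup>2 / 2 \<le> - (x - \<mu>)\<^sup>2 / (2 * \<sigma>\<^sup>2)"
      using assms by (simp add: field_simps power_mult_distrib)
    then have "1 / sqrt (2 * pi * \<sigma>\<^sup>2) * exp (- K\<^sup>2 / 2) \<le> normal_density \<mu> \<sigma> x"
      unfolding normal_density_def by (intro mult_left_mono) auto
    moreover have "1 / sqrt (2 * pi * \<sigma>\<^sup>2) * exp (- K\<^sup>2 / 2) = \<beta> / (2 * K * \<sigma>)"
      using assms by (simp add: \<beta>_def real_sqrt_mult)
    ultimately show ?thesis by simp
  qed
  have "ennreal \<beta> * (\<integral>\<^sup>+x. f x \<partial>centred_uniform \<mu> (K * \<sigma>)) =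
      ennreal \<beta> * ((\<integral>\<^sup>+x. f x * indicator ?I x \<partial>lborel) / ennreal (2 * K * \<sigma>))"
    unfolding centred_uniform_def using f assms by (subst nn_integral_uniform_measure) (auto simp: mult.assoc)
  also have "\<dots> = ennreal (\<beta> / (2 * K * \<sigma>)) * (\<integral>\<^sup>+x. f x * indicator ?I x \<partial>lborel)"
    unfolding divide_ennreal_def inverse_ennreal[OF c] divide_inverse ennreal_mult'[OF \<beta>]
    by (simp only: mult_ac)
  also have "\<dots> = (\<integral>\<^sup>+x. ennreal (\<beta> / (2 * K * \<sigma>)) * (f x * indicator ?I x) \<partial>lborel)"
    using f by (subst nn_integral_cmult) auto
  also have "\<dots> \<le> (\<integral>\<^sup>+x. ennreal (normal_density \<mu> \<sigma> x) * f x \<partial>lborel)"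
  proof (intro nn_integral_mono)
    fix x show "ennreal (\<beta> / (2 * K * \<sigma>)) * (f x * indicator ?I x) \<le> ennreal (normal_density \<mu> \<sigma> x) * f x"
      using dens[of x] by (cases "x \<in> ?I") (auto intro!: mult_right_mono ennreal_leI)
  qed
  also have "\<dots> = (\<integral>\<^sup>+x. f x \<partial>density lborel (normal_density \<mu> \<sigma>))"
    using f by (intro nn_integral_density[symmetric]) auto
  finally show ?thesis unfolding \<beta>_def .
qed

lemma small_ball_laws_normal:
  assumes "0 < \<sigma>" "0 < \<eta>"
  shows "small_ball_laws (\<lambda>i. density lborel (normal_density (\<mu> i) \<sigma>)) \<eta> (ennreal (\<eta> / \<sigma>))"
  by (rule small_ball_laws.intro) (use assms in \<open>simp_all only: prob_space_normal_density normal_small_ball less_imp_le sets_density sets_lborel\<close>)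

lemma small_ball_laws_centred_uniform:
  assumes "0 < r" "0 < \<eta>"
  shows "small_ball_laws (\<lambda>i. centred_uniform (\<mu> i) r) \<eta> (ennreal (\<eta> / r))"
  by (rule small_ball_laws.intro) (use assms in \<open>simp_all only: prob_space_centred_uniform centred_uniform_small_ball less_imp_le sets_centred_uniform\<close>)

section \<open>Joint law of the perturbed entries\<close>

definition noisy_law :: "(nat \<Rightarrow> real mat) \<Rightarrow> real \<Rightarrow> nat \<times> nat \<times> nat \<Rightarrow> real measure" where
  "noisy_law A \<sigma> z = density lborel (normal_density (A (fst z) $$ snd z) \<sigma>)"

text \<open>Deterministic shifts preserve independence, and independence means that the joint law is
  a product. \<open>Y\<close> is restricted to \<open>I\<close> so that its values lie in the
  product space.\<close>

lemma rho_perturbations_joint_law: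
  fixes M :: "'w measure"
  assumes pert: "rho_perturbations M \<rho> l n R A X" and "0 < \<rho>" "1 \<le> l" "1 \<le> n" "1 \<le> R"
  defines "I \<equiv> {1..l} \<times> {..<n} \<times> {..<R}"
  defines "Y \<equiv> \<lambda>\<omega>. \<lambda>z\<in>I. X (fst z) \<omega> $$ snd z"
  shows "Y \<in> measurable M (PiM I (noisy_law A (\<rho> / sqrt (real n))))"
    and "distr M (PiM I (noisy_law A (\<rho> / sqrt (real n)))) Y = PiM I (noisy_law A (\<rho> / sqrt (real n)))"
proof -
  define \<sigma> where "\<sigma> = \<rho> / sqrt (real n)"
  have \<sigma>: "0 < \<sigma>" using assms by (simp add: \<sigma>_def)
  interpret prob_space M using pert by (simp add: rho_perturbations_def)
  define Z where "Z z \<omega> = X (fst z) \<omega> $$ snd z - A (fst z) $$ snd z" for z and \<omega> :: 'w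
  have Z: "distributed M lborel (Z z) (normal_density 0 \<sigma>)" if "z \<in> I" for z
    using pert that unfolding rho_perturbations_def Z_def \<sigma>_def I_def by (cases z) auto
  have "(\<lambda>(k, i, j) \<omega>. X k \<omega> $$ (i, j) - A k $$ (i, j)) = Z"
    by (auto simp: Z_def fun_eq_iff)
  then have indep: "indep_vars (\<lambda>_. borel) Z I"
    using pert by (simp add: rho_perturbations_def I_def)
  \<comment> \<open>The factor 1 brings the shift into the affine form of
    \<open>normal_density_affine\<close>.\<close>
  have X_Z: "(\<lambda>\<omega>. X (fst z) \<omega> $$ snd z) = (\<lambda>\<omega>. A (fst z) $$ snd z + 1 * Z z \<omega>)" for z
    by (simp add: Z_def)
  have X: "distributed M lborel (\<lambda>\<omega>. X (fst z) \<omega> $$ snd z) (normal_density (A (fst z) $$ snd z) \<sigma>)"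
    if "z \<in> I" for z
    unfolding X_Z using normal_density_affine[OF Z[OF that] \<sigma>, of 1] by simp
  have rv: "random_variable borel (\<lambda>\<omega>. X (fst z) \<omega> $$ snd z)" if "z \<in> I" for z
    using distributed_measurable[OF X[OF that]] by simp
  have "indep_vars (\<lambda>_. borel) (\<lambda>z \<omega>. (\<lambda>t. A (fst z) $$ snd z + 1 * t) (Z z \<omega>)) I"
    by (rule indep_vars_compose2[OF indep]) auto
  then have "indep_vars (\<lambda>_. borel) (\<lambda>z \<omega>. X (fst z) \<omega> $$ snd z) I"
    unfolding X_Z .
  \<comment> \<open>The characterisation of independence by the joint law asks for a nonempty index
    set; this is where \<open>1 \<le> R\<close> enters.\<close>
  moreover have "(1, 0, 0) \<in> I" using assms(3-5) by (simp add: I_def)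
  then have "I \<noteq> {}" by blast
  ultimately have "distr M (PiM I (\<lambda>_. borel)) Y = PiM I (\<lambda>z. distr M borel (\<lambda>\<omega>. X (fst z) \<omega> $$ snd z))"
    unfolding Y_def using rv by (subst (asm) indep_vars_iff_distr_eq_PiM') auto
  also have "\<dots> = PiM I (noisy_law A \<sigma>)"
  proof (rule PiM_cong[OF refl])
    fix z assume "z \<in> I"
    have "distr M borel (\<lambda>\<omega>. X (fst z) \<omega> $$ snd z) = distr M lborel (\<lambda>\<omega>. X (fst z) \<omega> $$ snd z)"
      by (rule distr_cong) auto
    also have "\<dots> = noisy_law A \<sigma> z"
      unfolding noisy_law_def using distributed_distr_eq_density[OF X[OF \<open>z \<in> I\<close>]] .
    finally show "distr M borel (\<lambda>\<omega>. X (fst z) \<omega> $$ snd z) = noisy_law A \<sigma> z" .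
  qed
  finally have eq: "distr M (PiM I (\<lambda>_. borel)) Y = PiM I (noisy_law A \<sigma>)" .
  have sets: "sets (PiM I (noisy_law A \<sigma>)) = sets (PiM I (\<lambda>_. borel))"
    by (intro sets_PiM_cong) (auto simp: noisy_law_def)
  have "Y \<in> measurable M (PiM I (\<lambda>_. borel))"
    unfolding Y_def using rv by (rule measurable_restrict)
  then show "Y \<in> measurable M (PiM I (noisy_law A (\<rho> / sqrt (real n))))"
    using measurable_cong_sets[OF refl sets] unfolding \<sigma>_def by blast
  show "distr M (PiM I (noisy_law A (\<rho> / sqrt (real n)))) Y = PiM I (noisy_law A (\<rho> / sqrt (real n)))"
    using eq distr_cong[OF refl sets, of M Y Y] unfolding \<sigma>_def by simp
qed

section \<open>Arithmetic of thresholds and tails\<close>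

text \<open>The exponent count in powers of sqrt n: 4l for the two factors \<open>n ^ l\<close>, l
  for the standard deviation, and one to spare. Equality holds at l = 1.\<close>

lemma two_pow_three_ge: "1 \<le> l \<Longrightarrow> 5 * l + 1 \<le> 2 * 3 ^ (l::nat)"
  by (induction l rule: dec_induct) auto

text \<open>Verifies the condition on \<delta> in \<open>emeasure_ill_conditioned_le\<close> for
  \<delta> = 1/\<tau> and \<eta> equal to \<kappa> standard deviations. The spare factor
  \<open>sqrt (real n)\<close> pays for the surplus powers of \<rho>: a small \<kappa> requires a
  large \<open>n\<close>, a large \<kappa> allows every \<open>n\<close>.\<close>

lemma threshold_le:
  fixes \<rho> \<rho>max \<kappa> :: real
  assumes "1 \<le> l" "1 \<le> n" "0 < \<rho>" "\<rho> \<le> \<rho>max" "0 < \<kappa>" "\<rho>max ^ (3 ^ l - l) \<le> \<kappa> ^ l * sqrt (real n)"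
  shows "real (n ^ l) * real (n ^ l) * (\<rho> / real n) ^ 3 ^ l \<le> (\<kappa> * (\<rho> / sqrt (real n))) ^ l"
proof -
  define t where "t = sqrt (real n)"
  have t: "1 \<le> t" "real n = t\<^sup>2" using assms(2) by (simp_all add: t_def)
  have l3: "l \<le> 3 ^ l" "5 * l + 1 \<le> 2 * 3 ^ l" using two_pow_three_ge[OF assms(1)] by auto
  have "real (n ^ l) * real (n ^ l) * (\<rho> / real n) ^ 3 ^ l = t ^ (4 * l) * \<rho> ^ 3 ^ l / t ^ (2 * 3 ^ l)"
    unfolding of_nat_power t(2) power_divide by (simp flip: power_mult power_add)
  also have "\<dots> \<le> t ^ (4 * l) * \<rho> ^ 3 ^ l / t ^ (5 * l + 1)"
    using t assms(3) l3 by (intro divide_left_mono power_increasing) auto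
  also have "\<dots> = \<rho> ^ l * \<rho> ^ (3 ^ l - l) / (t ^ l * t)"
    using t l3 by (simp add: field_simps flip: power_add)
  also have "\<dots> \<le> \<rho> ^ l * (\<kappa> ^ l * t) / (t ^ l * t)"
  proof (intro divide_right_mono mult_left_mono)
    have "\<rho> ^ (3 ^ l - l) \<le> \<rho>max ^ (3 ^ l - l)" using assms by (intro power_mono) auto
    then show "\<rho> ^ (3 ^ l - l) \<le> \<kappa> ^ l * t" using assms(6) by (simp add: t_def)
  qed (use t assms in auto)
  also have "\<dots> = (\<kappa> * (\<rho> / t)) ^ l"
    using t by (simp add: power_mult_distrib power_divide)
  finally show ?thesis by (simp add: t_def)
qed

text \<open>The power of 1/2 decays at least like exp(-n ln 2 / (2l)). Half of this exponent is
  kept, whence the 4 in the rate, and the other half absorbs the polynomial.\<close>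

lemma poly_times_half_power_le_exp:
  assumes "1 \<le> l"
  shows "\<exists>n0. \<forall>n\<ge>n0. real (n ^ l) * real (l * (n div (2 * l) + 1) ^ l) * (1 / 2) ^ (n div (2 * l) + 1) \<le>
    exp (- (ln 2 / (4 * real l)) * real n)"
proof -
  define c where "c = ln 2 / (4 * real l)"
  have c: "0 < c" using assms by (simp add: c_def)
  have "(\<lambda>n. real n ^ (2 * l) * exp (- (c * real n))) \<longlonglongrightarrow> 0"
  proof -
    have "filterlim (\<lambda>n. c * real n) at_top sequentially"
      by (rule filterlim_tendsto_pos_mult_at_top[OF tendsto_const c filterlim_real_sequentially])
    from filterlim_compose[OF tendsto_power_div_exp_0[of "2 * l"] this]
    have "(\<lambda>n. 1 / c ^ (2 * l) * ((c * real n) ^ (2 * l) / exp (c * real n))) \<longlonglongrightarrow> 0"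
      by (rule tendsto_mult_right_zero)
    moreover have "1 / c ^ (2 * l) * ((c * real n) ^ (2 * l) / exp (c * real n)) =
        real n ^ (2 * l) * exp (- (c * real n))" for n
      using c by (simp add: power_mult_distrib exp_minus field_simps)
    ultimately show ?thesis by simp
  qed
  then have "\<forall>\<^sub>F n in sequentially. real n ^ (2 * l) * exp (- (c * real n)) < 1 / (real l * 2 ^ l)"
    using assms by (intro order_tendstoD(2)) auto
  then obtain n0 where n0: "\<And>n. n0 \<le> n \<Longrightarrow> real n ^ (2 * l) * exp (- (c * real n)) < 1 / (real l * 2 ^ l)"
    by (auto simp: eventually_sequentially)
  have "real (n ^ l) * real (l * (n div (2 * l) + 1) ^ l) * (1 / 2) ^ (n div (2 * l) + 1) \<le> exp (- c * real n)"
    if n: "max n0 1 \<le> n" for n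
  proof -
    define s where "s = n div (2 * l) + 1"
    have "s \<le> n + 1" unfolding s_def by simp
    then have s: "s \<le> 2 * n" using n by simp
    have "n < 2 * l * s" unfolding s_def using assms by (simp add: dividend_less_times_div)
    then have "real n \<le> real (2 * l * s)" by (intro of_nat_mono) simp
    then have "real n \<le> 2 * real l * real s" by simp
    then have "c * real n * 2 \<le> real s * ln 2"
      using assms by (simp add: c_def field_simps)
    then have "(1 / 2) ^ s \<le> exp (- (c * real n)) * exp (- (c * real n))"
    proof -
      have "(1 / 2 :: real) ^ s = exp (- (real s * ln 2))"
      proof -
        have "exp (- (real s * ln 2)) = exp (- ln 2 :: real) ^ s" by (simp flip: exp_of_nat_mult)
        also have "exp (- ln 2 :: real) = 1 / 2" by (simp add: exp_minus inverse_eq_divide)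
        finally show ?thesis by simp
      qed
      also have "\<dots> \<le> exp (- (c * real n) + - (c * real n))"
        using \<open>c * real n * 2 \<le> real s * ln 2\<close> by simp
      finally show ?thesis unfolding exp_add .
    qed
    then have "real (n ^ l) * real (l * s ^ l) * (1 / 2) ^ s \<le>
        real (n ^ l) * real (l * (2 * n) ^ l) * (exp (- (c * real n)) * exp (- (c * real n)))"
      using s by (intro mult_mono of_nat_mono power_mono) auto
    also have "\<dots> = real l * 2 ^ l * (real n ^ (2 * l) * exp (- (c * real n))) * exp (- (c * real n))"
    proof -
      have "real n ^ (2 * l) = real n ^ l * real n ^ l" by (simp only: mult_2 power_add)
      then show ?thesis by (simp add: power_mult_distrib)
    qed
    also have "\<dots> \<le> 1 * exp (- (c * real n))"
    proof (intro mult_right_mono)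
      show "real l * 2 ^ l * (real n ^ (2 * l) * exp (- (c * real n))) \<le> 1"
        using n0[of n] n assms by (simp add: field_simps)
    qed simp
    finally show ?thesis by (simp add: s_def)
  qed
  then show ?thesis unfolding c_def by blast
qed

section \<open>From the product law to the sample space\<close>

text \<open>A deficient rank comes with a rational certificate, so every sample point that
  \<open>Y\<close> sends outside the ill-conditioned set has full rank. This inclusion of events
  gives the lower bound.\<close>

lemma measure_robust_krank_ge:
  fixes M :: "'w measure"
  assumes pert: "rho_perturbations M \<rho> l n R A X" and "0 < \<rho>" "1 \<le> l" "1 \<le> n" "1 \<le> R" "0 < \<tau>"
    and laws: "tensor_laws (noisy_law A (\<rho> / sqrt (real n))) \<eta> p n"
  defines "P \<equiv> PiM ({1..l} \<times> {..<n} \<times> {..<R}) (noisy_law A (\<rho> / sqrt (real n)))"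
  shows "ennreal (measure M {\<omega> \<in> space M. robust_krank \<tau> (khatri_rao_prod l (\<lambda>k. X k \<omega>)) = R}) \<ge>
    emeasure P (space P - tensor_laws.ill_conditioned (noisy_law A (\<rho> / sqrt (real n))) n l R (1 / \<tau>))"
proof -
  interpret M: prob_space M using pert by (simp add: rho_perturbations_def)
  interpret tensor_laws "noisy_law A (\<rho> / sqrt (real n))" \<eta> p n by (rule laws)
  define I where "I = {1..l} \<times> {..<n} \<times> {..<R}"
  define Y where "Y = (\<lambda>\<omega>. \<lambda>z\<in>I. X (fst z) \<omega> $$ snd z)"
  let ?B = "\<lambda>\<omega>. khatri_rao_prod l (\<lambda>k. X k \<omega>)"
  define E where "E = {\<omega> \<in> space M. robust_krank \<tau> (?B \<omega>) = R}"
  define W where "W = space P - ill_conditioned l R (1 / \<tau>)"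
  have Y: "Y \<in> measurable M P" "distr M P Y = P"
    unfolding P_def Y_def I_def
    by (rule rho_perturbations_joint_law[OF pert assms(2-5)])+
  have X: "X k \<omega> \<in> carrier_mat n R" if "\<omega> \<in> space M" "k \<in> {1..l}" for k \<omega>
    using pert that by (simp add: rho_perturbations_def)
  have B: "?B \<omega> \<in> carrier_mat (n ^ l) R"
    "\<And>q j. q < n ^ l \<Longrightarrow> j < R \<Longrightarrow> ?B \<omega> $$ (q, j) = kr_entry n l (Y \<omega>) q j" if "\<omega> \<in> space M" for \<omega>
  proof -
    note entries = khatri_rao_prod_entries[OF assms(3,4), of "\<lambda>k. X k \<omega>" R, OF X[OF that]]
    show "?B \<omega> \<in> carrier_mat (n ^ l) R" using entries by blast
    fix q j assume qj: "q < n ^ l" "j < R"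
    then have "?B \<omega> $$ (q, j) = tensor_entry n l (\<lambda>k i. X k \<omega> $$ (i, j)) q" using entries by blast
    also have "\<dots> = kr_entry n l (Y \<omega>) q j"
      unfolding kr_entry_def using assms(4) qj by (intro tensor_entry_cong) (auto simp: Y_def I_def)
    finally show "?B \<omega> $$ (q, j) = kr_entry n l (Y \<omega>) q j" .
  qed
  have E: "E \<in> sets M"
    unfolding E_def
  proof (rule sets_robust_krank_eq[OF B(1) assms(6)])
    fix q j assume qj: "q < n ^ l" "j < R"
    have "(\<lambda>\<omega>. kr_entry n l (Y \<omega>) q j) \<in> borel_measurable M"
      using measurable_compose[OF Y(1)[unfolded P_def] kr_entry_measurable[OF qj(2)]] .
    then show "(\<lambda>\<omega>. ?B \<omega> $$ (q, j)) \<in> borel_measurable M"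
      using B(2) qj by (subst measurable_cong) auto
  qed
  have W: "W \<in> sets P" unfolding W_def P_def using sets_ill_conditioned by auto
  have sub: "Y -` W \<inter> space M \<subseteq> E"
  proof
    fix \<omega> assume \<omega>: "\<omega> \<in> Y -` W \<inter> space M"
    show "\<omega> \<in> E"
    proof (rule ccontr)
      assume "\<omega> \<notin> E"
      then have "robust_krank \<tau> (?B \<omega>) \<noteq> R" using \<omega> by (simp add: E_def)
      from robust_krank_deficient_small_image[OF B(1) assms(6) this] \<omega>
      obtain u :: "rat list" where "small_image (n ^ l) R (1 / \<tau>) (\<lambda>q j. ?B \<omega> $$ (q, j)) (\<lambda>j. of_rat (u ! j))"
        by blast
      then have "small_image (n ^ l) R (1 / \<tau>) (kr_entry n l (Y \<omega>)) (\<lambda>j. of_rat (u ! j))"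
        using B(2) \<omega> by (simp add: small_image_def)
      then have "Y \<omega> \<in> ill_conditioned l R (1 / \<tau>)"
        using \<omega> unfolding W_def P_def ill_conditioned_def by blast
      with \<omega> show False by (simp add: W_def)
    qed
  qed
  have "emeasure P W = emeasure M (Y -` W \<inter> space M)"
    using Y W by (metis emeasure_distr)
  also have "\<dots> \<le> emeasure M E" by (rule emeasure_mono[OF sub E])
  finally show ?thesis unfolding E_def W_def M.emeasure_eq_measure .
qed

lemma tensor_laws_noisy:
  assumes "0 < \<sigma>" "0 < \<eta>" "1 \<le> n"
  shows "tensor_laws (noisy_law A \<sigma>) \<eta> (ennreal (\<eta> / \<sigma>)) n"
  using small_ball_laws_normal[OF assms(1,2), of "\<lambda>z. A (fst z) $$ snd z"] assms(3)
  unfolding noisy_law_def[abs_def] by (intro tensor_laws.intro tensor_laws_axioms.intro)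

lemma tensor_laws_centred_uniform:
  assumes "0 < r" "0 < \<eta>" "1 \<le> n"
  shows "tensor_laws (\<lambda>z. centred_uniform (A (fst z) $$ snd z) r) \<eta> (ennreal (\<eta> / r)) n"
  using small_ball_laws_centred_uniform[OF assms(1,2), of "\<lambda>z. A (fst z) $$ snd z"] assms(3)
  by (intro tensor_laws.intro tensor_laws_axioms.intro)

lemma (in tensor_laws) measure_well_conditioned_ge:
  assumes "1 \<le> s" "R + l * ((s - 1) * n ^ (l - 1)) \<le> n ^ l" "0 < \<delta>" "0 \<le> p'" "p = ennreal p'"
    and "real (n ^ l) * real (n ^ l) * \<delta> \<le> \<eta> ^ l"
  defines "P \<equiv> PiM ({1..l} \<times> {..<n} \<times> {..<R}) law"
  shows "emeasure P (space P - ill_conditioned l R \<delta>) \<ge> ennreal (1 - real (R * (l * s ^ l)) * p' ^ s)"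
proof -
  interpret P: prob_space P unfolding P_def by (rule prob_space_PiM_law)
  have meas: "ill_conditioned l R \<delta> \<in> sets P" unfolding P_def by (rule sets_ill_conditioned)
  have "emeasure P (ill_conditioned l R \<delta>) \<le> of_nat (R * (l * s ^ l)) * p ^ s"
    unfolding P_def by (rule emeasure_ill_conditioned_le[OF assms(1-3,6)])
  also have "\<dots> = ennreal (real (R * (l * s ^ l)) * p' ^ s)"
    using assms(4) unfolding assms(5) by (simp only: ennreal_power ennreal_of_nat_eq_real_of_nat ennreal_mult' of_nat_0_le_iff)
  finally have "measure P (ill_conditioned l R \<delta>) \<le> real (R * (l * s ^ l)) * p' ^ s"
    using assms(4) unfolding P.emeasure_eq_measure by (subst (asm) ennreal_le_iff) auto
  then show ?thesis
    unfolding P.emeasure_eq_measure P.prob_compl[OF meas] by (intro ennreal_leI) simp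
qed

lemma inverse_tau: "1 / (real n / \<rho>) ^ k = (\<rho> / real n) ^ k"
  by (simp add: power_divide)

section \<open>The two ranges of \<open>n\<close>\<close>

text \<open>Half a standard deviation as \<eta> gives \<open>p = 1/2\<close>. The choice
  \<open>s = n div (2 * l) + 1\<close> is the largest for which the budget of the tree stays within
  half of the rows, the other half being reserved for the columns.\<close>

lemma robust_krank_probability_large:
  assumes "1 \<le> l" "0 < \<rho>max"
  shows "\<exists>n0. \<forall>n R \<rho> (A :: nat \<Rightarrow> real mat) (M :: 'w measure) X. n0 \<le> n \<longrightarrow> 1 \<le> n \<longrightarrow> 1 \<le> R \<longrightarrow>
    real R \<le> real n ^ l / 2 \<longrightarrow> 0 < \<rho> \<longrightarrow> \<rho> \<le> \<rho>max \<longrightarrow> rho_perturbations M \<rho> l n R A X \<longrightarrow>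
    1 - exp (- (ln 2 / (4 * real l)) * real n) \<le> measure M {\<omega> \<in> space M.
      robust_krank ((real n / \<rho>) ^ 3 ^ l) (khatri_rao_prod l (\<lambda>k. X k \<omega>)) = R}"
proof -
  obtain n1 where n1: "\<And>n. n1 \<le> n \<Longrightarrow> real (n ^ l) * real (l * (n div (2 * l) + 1) ^ l) * (1 / 2) ^ (n div (2 * l) + 1) \<le>
    exp (- (ln 2 / (4 * real l)) * real n)"
    using poly_times_half_power_le_exp[OF assms(1)] by blast
  \<comment> \<open>From \<open>n2\<close> on, the hypothesis of \<open>threshold_le\<close> holds
    with \<kappa> = 1/2.\<close>
  define n2 where "n2 = nat \<lceil>(2 ^ l * \<rho>max ^ (3 ^ l - l))\<^sup>2\<rceil>"
  show ?thesis
  proof (intro exI[of _ "max n1 n2"] allI impI)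
    fix n R \<rho> and A :: "nat \<Rightarrow> real mat" and M :: "'w measure" and X
    assume n: "max n1 n2 \<le> n" "1 \<le> n" and R: "1 \<le> R" "real R \<le> real n ^ l / 2"
      and \<rho>: "0 < \<rho>" "\<rho> \<le> \<rho>max" and pert: "rho_perturbations M \<rho> l n R A X"
    define \<sigma> where "\<sigma> = \<rho> / sqrt (real n)"
    have \<sigma>: "0 < \<sigma>" using \<rho> n by (simp add: \<sigma>_def)
    have laws: "tensor_laws (noisy_law A \<sigma>) (1 / 2 * \<sigma>) (ennreal (1 / 2)) n"
      using tensor_laws_noisy[OF \<sigma>, of "1 / 2 * \<sigma>" n A] \<sigma> n by simp
    interpret tensor_laws "noisy_law A \<sigma>" "1 / 2 * \<sigma>" "ennreal (1 / 2)" n by (rule laws)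
    define s where "s = n div (2 * l) + 1"
    define \<tau> where "\<tau> = (real n / \<rho>) ^ 3 ^ l"
    have \<tau>: "0 < \<tau>" using \<rho> n by (simp add: \<tau>_def)
    have "(2 ^ l * \<rho>max ^ (3 ^ l - l))\<^sup>2 \<le> real n2"
      unfolding n2_def by (rule real_nat_ceiling_ge)
    also have "\<dots> \<le> real n" using n by simp
    finally have "2 ^ l * \<rho>max ^ (3 ^ l - l) \<le> sqrt (real n)" by (rule real_le_rsqrt)
    then have "\<rho>max ^ (3 ^ l - l) \<le> (1 / 2) ^ l * sqrt (real n)" by (simp add: power_one_over field_simps)
    from threshold_le[OF assms(1) n(2) \<rho> _ this]
    have threshold: "real (n ^ l) * real (n ^ l) * (1 / \<tau>) \<le> (1 / 2 * \<sigma>) ^ l"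
      by (simp add: \<tau>_def \<sigma>_def inverse_tau)
    have rows: "R + l * ((s - 1) * n ^ (l - 1)) \<le> n ^ l"
    proof -
      have "real (2 * R) \<le> real (n ^ l)" using R by simp
      then have "2 * R \<le> n ^ l" by (rule of_nat_le_iff[THEN iffD1])
      moreover have "2 * (l * ((s - 1) * n ^ (l - 1))) \<le> n ^ l"
      proof -
        have "2 * (l * ((s - 1) * n ^ (l - 1))) = 2 * l * (n div (2 * l)) * n ^ (l - 1)"
          by (simp add: s_def mult.assoc)
        also have "\<dots> \<le> n * n ^ (l - 1)" by (intro mult_right_mono) auto
        also have "\<dots> = n ^ l" using assms(1) by (simp add: power_eq_if)
        finally show ?thesis .
      qed
      ultimately show ?thesis by linarith
    qed
    have "ennreal (1 - real (R * (l * s ^ l)) * (1 / 2) ^ s) \<le> ennreal (measure M {\<omega> \<in> space M.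
        robust_krank \<tau> (khatri_rao_prod l (\<lambda>k. X k \<omega>)) = R})"
      by (rule order_trans[OF measure_well_conditioned_ge[OF _ rows _ _ refl threshold]
            measure_robust_krank_ge[OF pert \<rho>(1) assms(1) n(2) R(1) \<tau> laws[unfolded \<sigma>_def], folded \<sigma>_def]])
        (use \<tau> in \<open>simp_all add: s_def\<close>)
    then have "1 - real (R * (l * s ^ l)) * (1 / 2) ^ s \<le> measure M {\<omega> \<in> space M.
        robust_krank \<tau> (khatri_rao_prod l (\<lambda>k. X k \<omega>)) = R}"
      by (simp only: ennreal_le_iff[OF measure_nonneg])
    moreover have "real (R * (l * s ^ l)) * (1 / 2) ^ s \<le> real (n ^ l) * real (l * s ^ l) * (1 / 2) ^ s"
      using rows by (simp only: of_nat_mult) (intro mult_right_mono, auto)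
    ultimately show "1 - exp (- (ln 2 / (4 * real l)) * real n) \<le> measure M {\<omega> \<in> space M.
      robust_krank ((real n / \<rho>) ^ 3 ^ l) (khatri_rao_prod l (\<lambda>k. X k \<omega>)) = R}"
      using n1[of n] n(1) unfolding s_def \<tau>_def by simp
  qed
qed

text \<open>With \<open>s = 1\<close> the tree costs no rows and the failure bound is
  \<open>R * l * \<epsilon>\<close>, at most 1/2. The Gaussian bound \<eta>/\<sigma> = \<kappa> is
  at least 1 at this scale and says nothing; a uniform law wide enough gives \<epsilon>, and
  domination transfers a positive share of its mass.\<close>

lemma robust_krank_probability_small:
  assumes "1 \<le> l" "0 < \<rho>max" "1 \<le> N"
  shows "\<exists>c>0. \<forall>n R \<rho> (A :: nat \<Rightarrow> real mat) (M :: 'w measure) X. n \<le> N \<longrightarrow> 1 \<le> n \<longrightarrow> 1 \<le> R \<longrightarrow>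
    real R \<le> real n ^ l / 2 \<longrightarrow> 0 < \<rho> \<longrightarrow> \<rho> \<le> \<rho>max \<longrightarrow> rho_perturbations M \<rho> l n R A X \<longrightarrow>
    c \<le> measure M {\<omega> \<in> space M.
      robust_krank ((real n / \<rho>) ^ 3 ^ l) (khatri_rao_prod l (\<lambda>k. X k \<omega>)) = R}"
proof -
  \<comment> \<open>\<epsilon> makes the union bound at most 1/2 for every \<open>n\<close> up to
    \<open>N\<close>; \<kappa> is at least 1 so that it does not exceed its \<open>l\<close>-th
    power in \<open>threshold_le\<close>; \<open>K\<close> makes \<epsilon> the ratio of \<eta> to
    the half-width; \<beta> is capped at 1 so that \<open>card I\<close> may be replaced by an upper
    bound in the exponent.\<close>
  define \<epsilon> where "\<epsilon> = 1 / (real l * real (N ^ l))"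
  define \<kappa> where "\<kappa> = max 1 (\<rho>max ^ (3 ^ l - l))"
  define K where "K = \<kappa> / \<epsilon>"
  define \<beta> where "\<beta> = min 1 (2 * K * exp (- K\<^sup>2 / 2) / sqrt (2 * pi))"
  have \<epsilon>: "0 < \<epsilon>" using assms by (simp add: \<epsilon>_def)
  have K: "0 < K" using \<epsilon> by (simp add: K_def \<kappa>_def)
  have \<beta>: "0 < \<beta>" "\<beta> \<le> 1" using K by (simp_all add: \<beta>_def)
  show ?thesis
  proof (intro exI[of _ "\<beta> ^ (l * (N * N ^ l)) / 2"] conjI allI impI)
    show "0 < \<beta> ^ (l * (N * N ^ l)) / 2" using \<beta> by simp
    fix n R \<rho> and A :: "nat \<Rightarrow> real mat" and M :: "'w measure" and X
    assume n: "n \<le> N" "1 \<le> n" and R: "1 \<le> R" "real R \<le> real n ^ l / 2"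
      and \<rho>: "0 < \<rho>" "\<rho> \<le> \<rho>max" and pert: "rho_perturbations M \<rho> l n R A X"
    define \<sigma> where "\<sigma> = \<rho> / sqrt (real n)"
    have \<sigma>: "0 < \<sigma>" using \<rho> n by (simp add: \<sigma>_def)
    define unif where "unif z = centred_uniform (A (fst z) $$ snd z) (K * \<sigma>)" for z
    define I where "I = {1..l} \<times> {..<n} \<times> {..<R}"
    define \<tau> where "\<tau> = (real n / \<rho>) ^ 3 ^ l"
    have \<tau>: "0 < \<tau>" using \<rho> n by (simp add: \<tau>_def)
    have lawsG: "tensor_laws (noisy_law A \<sigma>) \<sigma> (ennreal 1) n"
      using tensor_laws_noisy[OF \<sigma> \<sigma> n(2), of A] \<sigma> by simp
    have "tensor_laws unif (\<kappa> * \<sigma>) (ennreal (\<kappa> * \<sigma> / (K * \<sigma>))) n"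
      unfolding unif_def using tensor_laws_centred_uniform[of "K * \<sigma>" "\<kappa> * \<sigma>" n A] K \<sigma> n by (simp add: \<kappa>_def)
    moreover have "\<kappa> * \<sigma> / (K * \<sigma>) = \<epsilon>" using \<sigma> \<epsilon> by (simp add: K_def \<kappa>_def)
    ultimately have lawsU: "tensor_laws unif (\<kappa> * \<sigma>) (ennreal \<epsilon>) n" by simp
    interpret G: tensor_laws "noisy_law A \<sigma>" \<sigma> "ennreal 1" n by (rule lawsG)
    interpret U: tensor_laws unif "\<kappa> * \<sigma>" "ennreal \<epsilon>" n by (rule lawsU)
    have sets_eq: "sets (PiM I unif) = sets (PiM I (noisy_law A \<sigma>))"
      by (intro sets_PiM_cong) (simp_all add: G.sets_law U.sets_law)
    have "1 \<le> \<kappa>" "\<rho>max ^ (3 ^ l - l) \<le> \<kappa>" by (simp_all add: \<kappa>_def)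
    have "\<kappa> \<le> \<kappa> ^ l" using \<open>1 \<le> \<kappa>\<close> assms(1) by (intro self_le_power) auto
    also have "\<dots> \<le> \<kappa> ^ l * sqrt (real n)" using \<open>1 \<le> \<kappa>\<close> n(2) by simp
    finally have "\<rho>max ^ (3 ^ l - l) \<le> \<kappa> ^ l * sqrt (real n)" using \<open>\<rho>max ^ (3 ^ l - l) \<le> \<kappa>\<close> by simp
    from threshold_le[OF assms(1) n(2) \<rho> _ this]
    have threshold: "real (n ^ l) * real (n ^ l) * (1 / \<tau>) \<le> (\<kappa> * \<sigma>) ^ l"
      using \<open>1 \<le> \<kappa>\<close> by (simp add: \<tau>_def \<sigma>_def inverse_tau)
    have nN: "n ^ l \<le> N ^ l" using n by (intro power_mono) auto
    have "real (2 * R) \<le> real (n ^ l)" using R by simp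
    then have twoR: "2 * R \<le> n ^ l" by (rule of_nat_le_iff[THEN iffD1])
    define W where "W = space (PiM I (noisy_law A \<sigma>)) - G.ill_conditioned l R (1 / \<tau>)"
    \<comment> \<open>The ill-conditioned set refers to the laws only through the space of their
      product, which is the same for both, so one event can be measured under either law.\<close>
    have W_U: "W = space (PiM I unif) - U.ill_conditioned l R (1 / \<tau>)"
      unfolding W_def G.ill_conditioned_def U.ill_conditioned_def I_def[symmetric]
      using sets_eq_imp_space_eq[OF sets_eq] by simp
    have W: "W \<in> sets (PiM I (noisy_law A \<sigma>))" unfolding W_def I_def using G.sets_ill_conditioned by auto
    have "ennreal (1 - real (R * (l * 1 ^ l)) * \<epsilon> ^ 1) \<le> emeasure (PiM I unif) W"
      unfolding W_U I_def
      by (rule U.measure_well_conditioned_ge[OF _ _ _ _ refl threshold]) (use twoR \<tau> \<epsilon> in auto)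
    moreover have "real (R * (l * 1 ^ l)) * \<epsilon> ^ 1 \<le> 1 / 2"
    proof -
      have "2 * real R \<le> real (N ^ l)" using of_nat_mono[OF order_trans[OF twoR nN], where 'a = real] by simp
      then show ?thesis using assms by (simp add: \<epsilon>_def field_simps)
    qed
    then have "ennreal (1 / 2) \<le> ennreal (1 - real (R * (l * 1 ^ l)) * \<epsilon> ^ 1)" by (intro ennreal_leI) simp
    ultimately have half: "ennreal (1 / 2) \<le> emeasure (PiM I unif) W" by (rule order_trans[rotated])
    have dom: "ennreal \<beta> * (\<integral>\<^sup>+x. f x \<partial>unif z) \<le> (\<integral>\<^sup>+x. f x \<partial>noisy_law A \<sigma> z)"
      if "f \<in> borel_measurable borel" for f z
    proof -
      have "ennreal \<beta> * (\<integral>\<^sup>+x. f x \<partial>unif z) \<le> ennreal (2 * K * exp (- K\<^sup>2 / 2) / sqrt (2 * pi)) * (\<integral>\<^sup>+x. f x \<partial>unif z)"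
        by (intro mult_right_mono ennreal_leI) (auto simp: \<beta>_def)
      also have "\<dots> \<le> (\<integral>\<^sup>+x. f x \<partial>noisy_law A \<sigma> z)"
        unfolding unif_def noisy_law_def by (rule normal_ge_centred_uniform[OF \<sigma> K that])
      finally show ?thesis .
    qed
    have "card I = l * (n * R)" by (simp add: I_def card_cartesian_product)
    also have "\<dots> \<le> l * (N * N ^ l)" using n(1) twoR nN by (intro mult_mono) auto
    finally have "\<beta> ^ (l * (N * N ^ l)) \<le> \<beta> ^ card I" using \<beta> by (intro power_decreasing) auto
    then have "ennreal (\<beta> ^ (l * (N * N ^ l)) / 2) \<le> ennreal (\<beta> ^ card I * (1 / 2))"
      by (intro ennreal_leI) simp
    also have "\<dots> = ennreal \<beta> ^ card I * ennreal (1 / 2)"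
      unfolding ennreal_power[OF less_imp_le[OF \<beta>(1)]] by (rule ennreal_mult') (use \<beta> in simp)
    also have "\<dots> \<le> ennreal \<beta> ^ card I * emeasure (PiM I unif) W"
      by (intro mult_left_mono half) simp
    also have "\<dots> = ennreal \<beta> ^ card I * (\<integral>\<^sup>+x. indicator W x \<partial>PiM I unif)"
      using W sets_eq by simp
    also have "\<dots> \<le> (\<integral>\<^sup>+x. indicator W x \<partial>PiM I (noisy_law A \<sigma>))"
      by (rule nn_integral_PiM_ge[OF G.prob_law G.sets_law U.prob_law U.sets_law dom])
        (use W in \<open>auto simp: I_def\<close>)
    also have "\<dots> = emeasure (PiM I (noisy_law A \<sigma>)) W" using W by simp
    also have "\<dots> \<le> ennreal (measure M {\<omega> \<in> space M.
        robust_krank \<tau> (khatri_rao_prod l (\<lambda>k. X k \<omega>)) = R})"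
      unfolding W_def I_def \<sigma>_def
      by (rule measure_robust_krank_ge[OF pert \<rho>(1) assms(1) n(2) R(1) \<tau> lawsG[unfolded \<sigma>_def]])
    finally show "\<beta> ^ (l * (N * N ^ l)) / 2 \<le> measure M {\<omega> \<in> space M.
      robust_krank ((real n / \<rho>) ^ 3 ^ l) (khatri_rao_prod l (\<lambda>k. X k \<omega>)) = R}"
      unfolding \<tau>_def by (subst (asm) ennreal_le_iff) auto
  qed
qed

section \<open>One constant for all \<open>n\<close>\<close>

theorem mainTheorem1:
  fixes l :: nat and \<rho>max :: real
  assumes "1 \<le> l" and "0 < \<rho>max"
  shows "\<exists>C>0. \<forall>(n::nat) (R::nat) (\<rho>::real) (A :: nat \<Rightarrow> real mat)
           (M :: 'w measure) (X :: nat \<Rightarrow> 'w \<Rightarrow> real mat).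
     1 \<le> n \<longrightarrow> real R \<le> real n ^ l / 2 \<longrightarrow>
     0 < \<rho> \<longrightarrow> \<rho> \<le> \<rho>max \<longrightarrow>
     (\<forall>k\<in>{1..l}. A k \<in> carrier_mat n R \<and> (\<forall>j<R. euclid_norm (col (A k) j) = 1)) \<longrightarrow>
     rho_perturbations M \<rho> l n R A X \<longrightarrow>
     measure M {\<omega> \<in> space M.
         robust_krank ((real n / \<rho>) ^ (3 ^ l)) (khatri_rao_prod l (\<lambda>k. X k \<omega>)) = R}
       \<ge> 1 - exp (- C * real n powr (1 / 3 ^ l))"
proof -
  obtain n0 where large: "\<forall>n R \<rho> (A :: nat \<Rightarrow> real mat) (M :: 'w measure) X. n0 \<le> n \<longrightarrow> 1 \<le> n \<longrightarrow> 1 \<le> R \<longrightarrow>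
    real R \<le> real n ^ l / 2 \<longrightarrow> 0 < \<rho> \<longrightarrow> \<rho> \<le> \<rho>max \<longrightarrow> rho_perturbations M \<rho> l n R A X \<longrightarrow>
    1 - exp (- (ln 2 / (4 * real l)) * real n) \<le> measure M {\<omega> \<in> space M.
      robust_krank ((real n / \<rho>) ^ 3 ^ l) (khatri_rao_prod l (\<lambda>k. X k \<omega>)) = R}"
    using robust_krank_probability_large[OF assms] by blast
  define N where "N = max n0 1"
  have N: "1 \<le> N" by (simp add: N_def)
  obtain c where c: "0 < c" and small: "\<forall>n R \<rho> (A :: nat \<Rightarrow> real mat) (M :: 'w measure) X. n \<le> N \<longrightarrow> 1 \<le> n \<longrightarrow> 1 \<le> R \<longrightarrow>
    real R \<le> real n ^ l / 2 \<longrightarrow> 0 < \<rho> \<longrightarrow> \<rho> \<le> \<rho>max \<longrightarrow> rho_perturbations M \<rho> l n R A X \<longrightarrow>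
    c \<le> measure M {\<omega> \<in> space M.
      robust_krank ((real n / \<rho>) ^ 3 ^ l) (khatri_rao_prod l (\<lambda>k. X k \<omega>)) = R}"
    using robust_krank_probability_small[OF assms N] by blast
  \<comment> \<open>The first term is the decay rate for large \<open>n\<close>. The second serves
    \<open>n \<le> N\<close>, where 1 - exp(-x) \<le> x and x \<le> C n \<le> c. Both cases use that
    the root of \<open>n\<close> is at most \<open>n\<close>.\<close>
  define C where "C = min (ln 2 / (4 * real l)) (c / real N)"
  have C: "0 < C" "C \<le> ln 2 / (4 * real l)" "C \<le> c / real N"
    using assms(1) c N by (auto simp: C_def)
  show ?thesis
  proof (intro exI[of _ C] conjI allI impI)
    fix n R \<rho> and A :: "nat \<Rightarrow> real mat" and M :: "'w measure" and X
    assume n: "1 \<le> n" and R: "real R \<le> real n ^ l / 2" and \<rho>: "0 < \<rho>" "\<rho> \<le> \<rho>max"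
      and pert: "rho_perturbations M \<rho> l n R A X"
    let ?E = "{\<omega> \<in> space M. robust_krank ((real n / \<rho>) ^ (3 ^ l)) (khatri_rao_prod l (\<lambda>k. X k \<omega>)) = R}"
    have "real n powr (1 / 3 ^ l) \<le> real n powr 1" using n by (intro powr_mono) auto
    then have root: "C * real n powr (1 / 3 ^ l) \<le> C * real n" using C n by (intro mult_left_mono) auto
    consider "R = 0" | "1 \<le> R" "n0 \<le> n" | "1 \<le> R" "n \<le> N" by (cases "R = 0"; cases "n0 \<le> n") (auto simp: N_def Suc_le_eq)
    then show "1 - exp (- C * real n powr (1 / 3 ^ l)) \<le> measure M ?E"
    proof cases
      \<comment> \<open>Without columns there are no noise entries for the joint law, but the rank
        is 0 at every sample point.\<close>
      case 1
      interpret prob_space M using pert by (simp add: rho_perturbations_def)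
      have "robust_krank ((real n / \<rho>) ^ (3 ^ l)) (khatri_rao_prod l (\<lambda>k. X k \<omega>)) = R" if "\<omega> \<in> space M" for \<omega>
      proof -
        have "khatri_rao_prod l (\<lambda>k. X k \<omega>) \<in> carrier_mat (n ^ l) R"
          using khatri_rao_prod_entries[OF assms(1) n, of "\<lambda>k. X k \<omega>" R] pert that
          by (simp add: rho_perturbations_def)
        from robust_krank_eq_dim_col_iff[OF this] show ?thesis using 1 by simp
      qed
      then have "?E = space M" by auto
      then show ?thesis using prob_space by simp
    next
      case 2
      have "1 - exp (- C * real n powr (1 / 3 ^ l)) \<le> 1 - exp (- (ln 2 / (4 * real l)) * real n)"
        using root mult_right_mono[OF C(2), of "real n"] by simp
      also have "\<dots> \<le> measure M ?E" using large 2 n R \<rho> pert by blast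
      finally show ?thesis .
    next
      case 3
      have "1 - exp (- C * real n powr (1 / 3 ^ l)) \<le> C * real n powr (1 / 3 ^ l)"
        using exp_ge_add_one_self[of "- C * real n powr (1 / 3 ^ l)"] by simp
      also have "\<dots> \<le> C * real n" by (rule root)
      also have "\<dots> \<le> c / real N * real N" using C 3 c by (intro mult_mono) auto
      also have "\<dots> = c" using N by simp
      also have "\<dots> \<le> measure M ?E" using small 3 n R \<rho> pert by blast
      finally show ?thesis .
    qed
  qed (rule C(1))
qed


end
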